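(* Let $\Gamma$ be a groupoid and let $R$ be a $\Gamma$-graded ring. If $R$ is right $\Gamma_0$-artinian and right gr-hereditary, then $R$ is right $\Gamma_0$-noetherian.
   Context: A groupoid $\Gamma$ is the set of morphisms of a small category in which all morphisms are invertible; $\Gamma_0\subseteq\Gamma$ is the set of identity morphisms; $d(\gamma)=\gamma^{-1}\gamma$, $r(\gamma)=\gamma\gamma^{-1}$; the product $\gamma\delta$ is defined iff $d(\gamma)=r(\delta)$. Rings are associative, not necessarily unital. A $\Gamma$-graded ring is a ring $R=\bigoplus_{\gamma\in\Gamma}R_\gamma$ (additive subgroups) with $R_\gamma R_\delta\subseteq R_{\gamma\delta}$ if $d(\gamma)=r(\delta)$ and $R_\gamma R_\delta=0$ otherwise; it is always assumed object unital: for each $e\in\Gamma_0$ the ring $R_e$ has an identity $1_e$ (possibly $0$) with $1_{r(\gamma)}a=a=a1_{d(\gamma)}$ for all $a\in R_\gamma$, $\gamma\in\Gamma$. A $\Gamma$-graded right $R$-module is a right $R$-module $M=\bigoplus_{\gamma}M_\gamma$ with $M_\sigma R_\tau\subseteq M_{\sigma\tau}$ if $d(\sigma)=r(\tau)$, $M_\sigma R_\tau=0$ otherwise, and $m1_{d(\sigma)}=m$ for $m\in M_\sigma$. A submodule (or right ideal) $N$ of $M$ is graded if $N=\bigoplus_\gamma (N\cap M_\gamma)$. A gr-homomorphism $g:M\to N$ of graded right modules is an $R$-homomorphism with $g(M_\sigma)\subseteq N_\sigma$ for all $\sigma\in\Gamma$. $R$ is right $\Gamma_0$-artinian (resp. right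 $\Gamma_0$-noetherian) if for every $e\in\Gamma_0$ there is no infinite strictly decreasing (resp. increasing) chain of graded right ideals of $R$ contained in $1_eR$. A $\Gamma$-graded right $R$-module $P$ is gr-projective if for all $\Gamma$-graded right $R$-modules $M,N$, every surjective gr-homomorphism $g:M\to N$ and every gr-homomorphism $h:P\to N$, there is a gr-homomorphism $h':P\to M$ with $g\circ h'=h$. $R$ is right gr-hereditary if every graded right ideal of $R$ is a gr-projective $R$-module. *)

theory Defs
  imports "HOL-Algebra.Ring"
begin

section \<open>Groupoids\<close>

text \<open>
  Categories are given by their sets of morphisms; \<open>src\<close> and \<open>tgt\<close> send a morphism to the
  identity morphism of its domain and codomain. The product \<open>cmp \<Gamma> \<gamma> \<delta>\<close> is only
  meaningful if \<open>src \<Gamma> \<gamma> = tgt \<Gamma> \<delta>\<close>.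
\<close>

record 'g category =
  Mor :: "'g set"
  src :: "'g \<Rightarrow> 'g"
  tgt :: "'g \<Rightarrow> 'g"
  cmp :: "'g \<Rightarrow> 'g \<Rightarrow> 'g"

locale small_category =
  fixes \<Gamma> :: "'g category"
  assumes src_closed: "\<gamma> \<in> Mor \<Gamma> \<Longrightarrow> src \<Gamma> \<gamma> \<in> Mor \<Gamma>"
    and tgt_closed: "\<gamma> \<in> Mor \<Gamma> \<Longrightarrow> tgt \<Gamma> \<gamma> \<in> Mor \<Gamma>"
    and src_src: "\<gamma> \<in> Mor \<Gamma> \<Longrightarrow> src \<Gamma> (src \<Gamma> \<gamma>) = src \<Gamma> \<gamma>"
    and tgt_src: "\<gamma> \<in> Mor \<Gamma> \<Longrightarrow> tgt \<Gamma> (src \<Gamma> \<gamma>) = src \<Gamma> \<gamma>"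
    and src_tgt: "\<gamma> \<in> Mor \<Gamma> \<Longrightarrow> src \<Gamma> (tgt \<Gamma> \<gamma>) = tgt \<Gamma> \<gamma>"
    and tgt_tgt: "\<gamma> \<in> Mor \<Gamma> \<Longrightarrow> tgt \<Gamma> (tgt \<Gamma> \<gamma>) = tgt \<Gamma> \<gamma>"
    and cmp_closed: "\<lbrakk>\<gamma> \<in> Mor \<Gamma>; \<delta> \<in> Mor \<Gamma>; src \<Gamma> \<gamma> = tgt \<Gamma> \<delta>\<rbrakk> \<Longrightarrow> cmp \<Gamma> \<gamma> \<delta> \<in> Mor \<Gamma>"
    and src_cmp: "\<lbrakk>\<gamma> \<in> Mor \<Gamma>; \<delta> \<in> Mor \<Gamma>; src \<Gamma> \<gamma> = tgt \<Gamma> \<delta>\<rbrakk> \<Longrightarrow> src \<Gamma> (cmp \<Gamma> \<gamma> \<delta>) = src \<Gamma> \<delta>"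
    and tgt_cmp: "\<lbrakk>\<gamma> \<in> Mor \<Gamma>; \<delta> \<in> Mor \<Gamma>; src \<Gamma> \<gamma> = tgt \<Gamma> \<delta>\<rbrakk> \<Longrightarrow> tgt \<Gamma> (cmp \<Gamma> \<gamma> \<delta>) = tgt \<Gamma> \<gamma>"
    and cmp_src: "\<gamma> \<in> Mor \<Gamma> \<Longrightarrow> cmp \<Gamma> \<gamma> (src \<Gamma> \<gamma>) = \<gamma>"
    and cmp_tgt: "\<gamma> \<in> Mor \<Gamma> \<Longrightarrow> cmp \<Gamma> (tgt \<Gamma> \<gamma>) \<gamma> = \<gamma>"
    and cmp_assoc: "\<lbrakk>\<gamma> \<in> Mor \<Gamma>; \<delta> \<in> Mor \<Gamma>; \<epsilon> \<in> Mor \<Gamma>; src \<Gamma> \<gamma> = tgt \<Gamma> \<delta>; src \<Gamma> \<delta> = tgt \<Gamma> \<epsilon>\<rbrakk>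
      \<Longrightarrow> cmp \<Gamma> (cmp \<Gamma> \<gamma> \<delta>) \<epsilon> = cmp \<Gamma> \<gamma> (cmp \<Gamma> \<delta> \<epsilon>)"

text \<open>In particular \<open>src\<close> and \<open>tgt\<close> are \<open>\<gamma> \<mapsto> \<gamma>\<^sup>-\<^sup>1\<gamma>\<close> and \<open>\<gamma> \<mapsto> \<gamma>\<gamma>\<^sup>-\<^sup>1\<close>.\<close>

locale groupoid = small_category \<Gamma> for \<Gamma> :: "'g category" +
  assumes invertible: "\<gamma> \<in> Mor \<Gamma> \<Longrightarrow> \<exists>\<delta>\<in>Mor \<Gamma>. src \<Gamma> \<delta> = tgt \<Gamma> \<gamma> \<and> tgt \<Gamma> \<delta> = src \<Gamma> \<gamma>
      \<and> cmp \<Gamma> \<delta> \<gamma> = src \<Gamma> \<gamma> \<and> cmp \<Gamma> \<gamma> \<delta> = tgt \<Gamma> \<gamma>"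

definition identities :: "'g category \<Rightarrow> 'g set"
  where "identities \<Gamma> = {e \<in> Mor \<Gamma>. src \<Gamma> e = e}"


section \<open>Right modules over non-unital rings, and gradings\<close>

text \<open>
  The ring is the whole of a type of class \<open>ring\<close>, which does not require a unit. Modules live
  on explicit carriers, so that one can quantify over them; of the underlying ring record only
  the additive part is used.
\<close>

record ('g, 'r, 'm) gr_module = "'m ring" +
  act :: "'m \<Rightarrow> 'r \<Rightarrow> 'm"
  component :: "'g \<Rightarrow> 'm set"

definition internal_direct_sum :: "('m, 'b) ring_scheme \<Rightarrow> 'i set \<Rightarrow> ('i \<Rightarrow> 'm set) \<Rightarrow> bool"
  where "internal_direct_sum M I A \<longleftrightarrow>
    (\<forall>i\<in>I. subgroup (A i) (add_monoid M)) \<and>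
    (\<forall>m\<in>carrier M. \<exists>!f. f \<in> (\<Pi>\<^sub>E i\<in>I. A i) \<and> finite {i\<in>I. f i \<noteq> \<zero>\<^bsub>M\<^esub>} \<and>
      finsum M f {i\<in>I. f i \<noteq> \<zero>\<^bsub>M\<^esub>} = m)"

definition regular_module :: "('g \<Rightarrow> 'r::ring set) \<Rightarrow> ('g, 'r, 'r) gr_module"
  where "regular_module R = \<lparr>carrier = UNIV, mult = (*), one = undefined, zero = 0, add = (+),
    act = (*), component = R\<rparr>"

definition unit_of :: "('g \<Rightarrow> 'r::ring set) \<Rightarrow> 'g \<Rightarrow> 'r"
  where "unit_of R e = (THE u. u \<in> R e \<and> (\<forall>a\<in>R e. u * a = a \<and> a * u = a))"

locale graded_ring = groupoid \<Gamma> for \<Gamma> :: "'g category" +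
  fixes R :: "'g \<Rightarrow> 'r::ring set"
  assumes ring_direct_sum: "internal_direct_sum (regular_module R) (Mor \<Gamma>) R"
    and ring_mult_comp: "\<lbrakk>\<gamma> \<in> Mor \<Gamma>; \<delta> \<in> Mor \<Gamma>; src \<Gamma> \<gamma> = tgt \<Gamma> \<delta>; a \<in> R \<gamma>; b \<in> R \<delta>\<rbrakk>
      \<Longrightarrow> a * b \<in> R (cmp \<Gamma> \<gamma> \<delta>)"
    and ring_mult_zero: "\<lbrakk>\<gamma> \<in> Mor \<Gamma>; \<delta> \<in> Mor \<Gamma>; src \<Gamma> \<gamma> \<noteq> tgt \<Gamma> \<delta>; a \<in> R \<gamma>; b \<in> R \<delta>\<rbrakk>
      \<Longrightarrow> a * b = 0"
    and unit_exists: "e \<in> identities \<Gamma> \<Longrightarrow> \<exists>u\<in>R e. \<forall>a\<in>R e. u * a = a \<and> a * u = a"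
    and unit_left: "\<lbrakk>\<gamma> \<in> Mor \<Gamma>; a \<in> R \<gamma>\<rbrakk> \<Longrightarrow> unit_of R (tgt \<Gamma> \<gamma>) * a = a"
    and unit_right: "\<lbrakk>\<gamma> \<in> Mor \<Gamma>; a \<in> R \<gamma>\<rbrakk> \<Longrightarrow> a * unit_of R (src \<Gamma> \<gamma>) = a"

locale right_module = abelian_group M for M :: "('g, 'r::ring, 'm) gr_module" (structure) +
  assumes act_closed: "m \<in> carrier M \<Longrightarrow> act M m a \<in> carrier M"
    and act_add_left: "\<lbrakk>m \<in> carrier M; n \<in> carrier M\<rbrakk> \<Longrightarrow> act M (m \<oplus> n) a = act M m a \<oplus> act M n a"
    and act_add_right: "m \<in> carrier M \<Longrightarrow> act M m (a + b) = act M m a \<oplus> act M m b"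
    and act_assoc: "m \<in> carrier M \<Longrightarrow> act M m (a * b) = act M (act M m a) b"

locale graded_module = right_module M
  for \<Gamma> :: "'g category" and R :: "'g \<Rightarrow> 'r::ring set" and M :: "('g, 'r, 'm) gr_module" (structure) +
  assumes module_direct_sum: "internal_direct_sum M (Mor \<Gamma>) (component M)"
    and act_comp: "\<lbrakk>\<sigma> \<in> Mor \<Gamma>; \<tau> \<in> Mor \<Gamma>; src \<Gamma> \<sigma> = tgt \<Gamma> \<tau>; m \<in> component M \<sigma>; a \<in> R \<tau>\<rbrakk>
      \<Longrightarrow> act M m a \<in> component M (cmp \<Gamma> \<sigma> \<tau>)"
    and act_zero: "\<lbrakk>\<sigma> \<in> Mor \<Gamma>; \<tau> \<in> Mor \<Gamma>; src \<Gamma> \<sigma> \<noteq> tgt \<Gamma> \<tau>; m \<in> component M \<sigma>; a \<in> R \<tau>\<rbrakk>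
      \<Longrightarrow> act M m a = \<zero>"
    and act_unit: "\<lbrakk>\<sigma> \<in> Mor \<Gamma>; m \<in> component M \<sigma>\<rbrakk> \<Longrightarrow> act M m (unit_of R (src \<Gamma> \<sigma>)) = m"

definition induced_module :: "('g, 'r, 'm) gr_module \<Rightarrow> 'm set \<Rightarrow> ('g, 'r, 'm) gr_module"
  where "induced_module M N = M\<lparr>carrier := N, component := (\<lambda>\<gamma>. N \<inter> component M \<gamma>)\<rparr>"

definition graded_submodule :: "'g category \<Rightarrow> ('g, 'r, 'm) gr_module \<Rightarrow> 'm set \<Rightarrow> bool"
  where "graded_submodule \<Gamma> M N \<longleftrightarrow>
    subgroup N (add_monoid M) \<and> (\<forall>n\<in>N. \<forall>a. act M n a \<in> N) \<and>
    internal_direct_sum (induced_module M N) (Mor \<Gamma>) (\<lambda>\<gamma>. N \<inter> component M \<gamma>)"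

abbreviation graded_right_ideal :: "'g category \<Rightarrow> ('g \<Rightarrow> 'r::ring set) \<Rightarrow> 'r set \<Rightarrow> bool"
  where "graded_right_ideal \<Gamma> R \<equiv> graded_submodule \<Gamma> (regular_module R)"

definition gr_hom :: "'g category \<Rightarrow> ('g, 'r, 'm) gr_module \<Rightarrow> ('g, 'r, 'n) gr_module \<Rightarrow> ('m \<Rightarrow> 'n) set"
  where "gr_hom \<Gamma> M N = {g \<in> hom (add_monoid M) (add_monoid N).
    (\<forall>m\<in>carrier M. \<forall>a. g (act M m a) = act N (g m) a) \<and>
    (\<forall>\<sigma>\<in>Mor \<Gamma>. g ` component M \<sigma> \<subseteq> component N \<sigma>)}"


section \<open>Chain conditions, projectivity, hereditary rings\<close>

definition right_artinian :: "'g category \<Rightarrow> ('g \<Rightarrow> 'r::ring set) \<Rightarrow> bool"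
  where "right_artinian \<Gamma> R \<longleftrightarrow> (\<forall>e\<in>identities \<Gamma>.
    \<not> (\<exists>I :: nat \<Rightarrow> 'r set. \<forall>n. graded_right_ideal \<Gamma> R (I n) \<and>
        I n \<subseteq> range (\<lambda>a. unit_of R e * a) \<and> I (Suc n) \<subset> I n))"

definition right_noetherian :: "'g category \<Rightarrow> ('g \<Rightarrow> 'r::ring set) \<Rightarrow> bool"
  where "right_noetherian \<Gamma> R \<longleftrightarrow> (\<forall>e\<in>identities \<Gamma>.
    \<not> (\<exists>I :: nat \<Rightarrow> 'r set. \<forall>n. graded_right_ideal \<Gamma> R (I n) \<and>
        I n \<subseteq> range (\<lambda>a. unit_of R e * a) \<and> I n \<subset> I (Suc n)))"

definition lifts_along ::
  "'g category \<Rightarrow> ('g, 'r, 'p) gr_module \<Rightarrow> ('g, 'r, 'm) gr_module \<Rightarrow> ('g, 'r, 'n) gr_module \<Rightarrow> bool"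
  where "lifts_along \<Gamma> P M N \<longleftrightarrow>
    (\<forall>g\<in>gr_hom \<Gamma> M N. \<forall>h\<in>gr_hom \<Gamma> P N. g ` carrier M = carrier N \<longrightarrow>
      (\<exists>h'\<in>gr_hom \<Gamma> P M. \<forall>x\<in>carrier P. g (h' x) = h x))"

text \<open>
  A definition cannot quantify over the carrier types of \<open>M\<close> and \<open>N\<close>. The types chosen here
  have room for \<open>N = P\<close> and for a graded free module \<open>M\<close> mapping onto \<open>P\<close>, hence the
  definition implies the lifting property for modules over all types; this is the theorem
  \<open>gr_projective_lifts_along\<close> below. The first conjunct holds for every graded right ideal,
  see \<open>regular_graded_module\<close> and \<open>graded_submodule_graded_module\<close>.
\<close>

definition gr_projective :: "'g category \<Rightarrow> ('g \<Rightarrow> 'r::ring set) \<Rightarrow> ('g, 'r, 'p) gr_module \<Rightarrow> bool"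
  where "gr_projective \<Gamma> R P \<longleftrightarrow> graded_module \<Gamma> R P \<and>
    (\<forall>(M :: ('g, 'r, 'p \<Rightarrow> 'r) gr_module) (N :: ('g, 'r, 'p) gr_module).
      graded_module \<Gamma> R M \<longrightarrow> graded_module \<Gamma> R N \<longrightarrow> lifts_along \<Gamma> P M N)"

definition right_gr_hereditary :: "'g category \<Rightarrow> ('g \<Rightarrow> 'r::ring set) \<Rightarrow> bool"
  where "right_gr_hereditary \<Gamma> R \<longleftrightarrow>
    (\<forall>I. graded_right_ideal \<Gamma> R I \<longrightarrow> gr_projective \<Gamma> R (induced_module (regular_module R) I))"


section \<open>The lifting property over arbitrary carrier types\<close>

lemma (in abelian_monoid) finsum_neutral:
  assumes "finite B" "A \<subseteq> B" "\<And>i. i \<in> B - A \<Longrightarrow> f i = \<zero>" "f \<in> B \<rightarrow> carrier G"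
  shows "finsum G f A = finsum G f B"
  using assms by (intro add.finprod_mono_neutral_cong_left) auto

lemma finsum_additive:
  fixes g :: "'m \<Rightarrow> 'n"
  assumes "abelian_group M" "abelian_group N" "g \<in> hom (add_monoid M) (add_monoid N)"
    and "finite S" "f \<in> S \<rightarrow> carrier M"
  shows "g (finsum M f S) = finsum N (\<lambda>i. g (f i)) S"
proof -
  interpret M: abelian_group M by fact
  interpret N: abelian_group N by fact
  have cl: "g x \<in> carrier N" if "x \<in> carrier M" for x
    using assms(3) that by (auto simp: hom_def)
  have add: "g (x \<oplus>\<^bsub>M\<^esub> y) = g x \<oplus>\<^bsub>N\<^esub> g y" if "x \<in> carrier M" "y \<in> carrier M" for x y
    using assms(3) that by (auto simp: hom_def)
  have "g \<zero>\<^bsub>M\<^esub> \<oplus>\<^bsub>N\<^esub> g \<zero>\<^bsub>M\<^esub> = g \<zero>\<^bsub>M\<^esub>" using add[of "\<zero>\<^bsub>M\<^esub>" "\<zero>\<^bsub>M\<^esub>"] by simp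
  then have z: "g \<zero>\<^bsub>M\<^esub> = \<zero>\<^bsub>N\<^esub>" using cl[of "\<zero>\<^bsub>M\<^esub>"] by (simp add: N.add.l_cancel_one)
  show ?thesis using assms(4,5)
  proof (induction S rule: finite_induct)
    case empty then show ?case by (simp add: z)
  next
    case (insert i S)
    then have "f \<in> S \<rightarrow> carrier M" "f i \<in> carrier M" by auto
    then show ?case using insert by (simp add: add cl Pi_iff)
  qed
qed

lemma hom_additive_zero:
  assumes "abelian_group M" "abelian_group N" "g \<in> hom (add_monoid M) (add_monoid N)"
  shows "g \<zero>\<^bsub>M\<^esub> = \<zero>\<^bsub>N\<^esub>"
  using finsum_additive[OF assms, of "{}"] assms(1,2) by (simp add: abelian_group_def abelian_monoid.finsum_empty)

lemma add_subgroup_finsum: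
  assumes "abelian_group M" "subgroup A (add_monoid M)" "finite S" "\<And>i. i \<in> S \<Longrightarrow> f i \<in> A"
  shows "finsum M f S \<in> A"
proof -
  interpret M: abelian_group M by fact
  have sub: "A \<subseteq> carrier M" using subgroup.subset[OF assms(2)] by simp
  show ?thesis using assms(3,4)
  proof (induction S rule: finite_induct)
    case empty then show ?case using subgroup.one_closed[OF assms(2)] by simp
  next
    case (insert i S)
    then have "finsum M f (insert i S) = f i \<oplus>\<^bsub>M\<^esub> finsum M f S"
      using sub by (intro M.finsum_insert) auto
    then show ?case using subgroup.m_closed[OF assms(2), of "f i" "finsum M f S"] insert by simp
  qed
qed

definition projections :: "('m, 'b) ring_scheme \<Rightarrow> 'i set \<Rightarrow> ('i \<Rightarrow> 'm set) \<Rightarrow> ('i \<Rightarrow> 'm \<Rightarrow> 'm) \<Rightarrow> bool"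
  where "projections M I A \<pi> \<longleftrightarrow>
    (\<forall>i\<in>I. \<forall>m\<in>carrier M. \<pi> i m \<in> A i) \<and>
    (\<forall>i\<in>I. \<pi> i \<in> hom (add_monoid M) (add_monoid M)) \<and>
    (\<forall>i\<in>I. \<forall>m\<in>A i. \<pi> i m = m) \<and>
    (\<forall>i\<in>I. \<forall>j\<in>I. i \<noteq> j \<longrightarrow> (\<forall>m\<in>A j. \<pi> i m = \<zero>\<^bsub>M\<^esub>)) \<and>
    (\<forall>m\<in>carrier M. finite {i\<in>I. \<pi> i m \<noteq> \<zero>\<^bsub>M\<^esub>} \<and>
       finsum M (\<lambda>i. \<pi> i m) {i\<in>I. \<pi> i m \<noteq> \<zero>\<^bsub>M\<^esub>} = m)"

lemma internal_direct_sumI: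
  assumes M: "abelian_group M"
    and sub: "\<And>i. i \<in> I \<Longrightarrow> subgroup (A i) (add_monoid M)"
    and pr: "projections M I A \<pi>"
  shows "internal_direct_sum M I A"
  unfolding internal_direct_sum_def
proof (intro conjI ballI)
  interpret M: abelian_group M by fact
  have subc: "A i \<subseteq> carrier M" if "i \<in> I" for i using subgroup.subset[OF sub[OF that]] by simp
  fix m assume m: "m \<in> carrier M"
  let ?D = "\<lambda>f. f \<in> (\<Pi>\<^sub>E i\<in>I. A i) \<and> finite {i\<in>I. f i \<noteq> \<zero>\<^bsub>M\<^esub>} \<and>
      finsum M f {i\<in>I. f i \<noteq> \<zero>\<^bsub>M\<^esub>} = m"
  show "\<exists>!f. ?D f"
  proof (rule ex1I)
    let ?f = "restrict (\<lambda>i. \<pi> i m) I"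
    have e: "{i\<in>I. ?f i \<noteq> \<zero>\<^bsub>M\<^esub>} = {i\<in>I. \<pi> i m \<noteq> \<zero>\<^bsub>M\<^esub>}" by auto
    have "finsum M ?f {i\<in>I. \<pi> i m \<noteq> \<zero>\<^bsub>M\<^esub>} = finsum M (\<lambda>i. \<pi> i m) {i\<in>I. \<pi> i m \<noteq> \<zero>\<^bsub>M\<^esub>}"
      using pr m subc by (intro M.finsum_cong') (auto simp: projections_def)
    then show "?D ?f" unfolding e using pr m by (auto simp: projections_def)
  next
    fix f assume f: "?D f"
    let ?S = "{i\<in>I. f i \<noteq> \<zero>\<^bsub>M\<^esub>}"
    have "f j = \<pi> j m" if j: "j \<in> I" for j
    proof -
      have fc: "f i \<in> A i" if "i \<in> I" for i using f that by auto
      have fcc: "f i \<in> carrier M" if "i \<in> I" for i using fc[OF that] subc[OF that] by auto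
      have h: "\<pi> j \<in> hom (add_monoid M) (add_monoid M)" using pr j by (auto simp: projections_def)
      have "\<pi> j m = \<pi> j (finsum M f ?S)" using f by auto
      also have "\<dots> = finsum M (\<lambda>i. \<pi> j (f i)) ?S"
        using f fcc by (intro finsum_additive[OF M M h]) auto
      also have "\<dots> = finsum M (\<lambda>i. if j = i then f i else \<zero>\<^bsub>M\<^esub>) ?S"
        using pr j fc fcc by (intro M.finsum_cong') (auto simp: projections_def)
      also have "\<dots> = f j"
      proof (cases "f j = \<zero>\<^bsub>M\<^esub>")
        case True
        have "finsum M (\<lambda>i. if j = i then f i else \<zero>\<^bsub>M\<^esub>) ?S = finsum M (\<lambda>i. \<zero>\<^bsub>M\<^esub>) ?S"
          using True by (intro M.finsum_cong') auto
        then show ?thesis using True M.finsum_zero by simp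
      next
        case False
        then show ?thesis using f fcc j by (intro M.finsum_singleton) auto
      qed
      finally show ?thesis by simp
    qed
    moreover have "f \<in> extensional I" using f by (auto simp: PiE_def)
    ultimately show "f = restrict (\<lambda>i. \<pi> i m) I" by (auto simp: restrict_def extensional_def)
  qed
qed (use sub in auto)

lemma internal_direct_sum_projections:
  assumes M: "abelian_group M" and ds: "internal_direct_sum M I A"
  obtains \<pi> where "projections M I A \<pi>"
proof -
  interpret M: abelian_group M by fact
  have sub: "subgroup (A i) (add_monoid M)" if "i \<in> I" for i
    using ds that by (auto simp: internal_direct_sum_def)
  have subc: "A i \<subseteq> carrier M" if "i \<in> I" for i using subgroup.subset[OF sub[OF that]] by simp
  have zero: "\<zero>\<^bsub>M\<^esub> \<in> A i" if "i \<in> I" for i using subgroup.one_closed[OF sub[OF that]] by simp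
  define D where "D m f \<longleftrightarrow> f \<in> (\<Pi>\<^sub>E i\<in>I. A i) \<and> finite {i\<in>I. f i \<noteq> \<zero>\<^bsub>M\<^esub>} \<and>
      finsum M f {i\<in>I. f i \<noteq> \<zero>\<^bsub>M\<^esub>} = m" for m f
  have ex1: "\<exists>!f. D m f" if "m \<in> carrier M" for m
    using ds that unfolding D_def internal_direct_sum_def by blast
  define p where "p m = (THE f. D m f)" for m
  have Dp: "D m (p m)" if "m \<in> carrier M" for m
    unfolding p_def by (rule theI'[OF ex1[OF that]])
  have uniq: "p m i = f i"
    if f: "\<And>i. i \<in> I \<Longrightarrow> f i \<in> A i" and T: "finite T" "T \<subseteq> I" "\<And>i. i \<in> I - T \<Longrightarrow> f i = \<zero>\<^bsub>M\<^esub>"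
      and s: "finsum M f T = m" and i: "i \<in> I" for m f T i
  proof -
    have fc: "f i \<in> carrier M" if "i \<in> I" for i using f[OF that] subc[OF that] by auto
    have m: "m \<in> carrier M" unfolding s[symmetric] using fc T by (intro M.finsum_closed) auto
    let ?f = "restrict f I"
    have st: "{i\<in>I. ?f i \<noteq> \<zero>\<^bsub>M\<^esub>} \<subseteq> T" using T by auto
    have "finsum M ?f {i\<in>I. ?f i \<noteq> \<zero>\<^bsub>M\<^esub>} = finsum M ?f T"
      using T st fc by (intro M.finsum_neutral) auto
    also have "\<dots> = finsum M f T" using T fc by (intro M.finsum_cong') auto
    finally have "D m ?f" unfolding D_def using f s finite_subset[OF st T(1)] by auto
    then have "p m = ?f" using Dp[OF m] ex1[OF m] by auto
    then show ?thesis using i by simp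
  qed
  have pA: "p m i \<in> A i" if "m \<in> carrier M" "i \<in> I" for m i
    using Dp[OF that(1)] that(2) by (auto simp: D_def)
  have pc: "p m i \<in> carrier M" if "m \<in> carrier M" "i \<in> I" for m i
    using pA[OF that] subc[OF that(2)] by auto
  have pfin: "finite {i\<in>I. p m i \<noteq> \<zero>\<^bsub>M\<^esub>}" if "m \<in> carrier M" for m
    using Dp[OF that] by (auto simp: D_def)
  have psum: "finsum M (p m) {i\<in>I. p m i \<noteq> \<zero>\<^bsub>M\<^esub>} = m" if "m \<in> carrier M" for m
    using Dp[OF that] by (auto simp: D_def)
  have padd: "p (m \<oplus>\<^bsub>M\<^esub> n) i = p m i \<oplus>\<^bsub>M\<^esub> p n i"
    if m: "m \<in> carrier M" and n: "n \<in> carrier M" and i: "i \<in> I" for m n i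
  proof -
    let ?T = "{i\<in>I. p m i \<noteq> \<zero>\<^bsub>M\<^esub>} \<union> {i\<in>I. p n i \<noteq> \<zero>\<^bsub>M\<^esub>}"
    have T: "finite ?T" using pfin[OF m] pfin[OF n] by simp
    have 1: "finsum M (p m) ?T = m"
    proof -
      have "finsum M (p m) {i\<in>I. p m i \<noteq> \<zero>\<^bsub>M\<^esub>} = finsum M (p m) ?T"
        using T pc[OF m] by (intro M.finsum_neutral) auto
      then show ?thesis using psum[OF m] by simp
    qed
    have 2: "finsum M (p n) ?T = n"
    proof -
      have "finsum M (p n) {i\<in>I. p n i \<noteq> \<zero>\<^bsub>M\<^esub>} = finsum M (p n) ?T"
        using T pc[OF n] by (intro M.finsum_neutral) auto
      then show ?thesis using psum[OF n] by simp
    qed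
    have "finsum M (\<lambda>i. p m i \<oplus>\<^bsub>M\<^esub> p n i) ?T = finsum M (p m) ?T \<oplus>\<^bsub>M\<^esub> finsum M (p n) ?T"
      using pc[OF m] pc[OF n] by (intro M.finsum_addf) auto
    also have "\<dots> = m \<oplus>\<^bsub>M\<^esub> n" using 1 2 by simp
    finally have s: "finsum M (\<lambda>i. p m i \<oplus>\<^bsub>M\<^esub> p n i) ?T = m \<oplus>\<^bsub>M\<^esub> n" .
    show ?thesis
    proof (rule uniq[OF _ T _ _ s i])
      show "p m i \<oplus>\<^bsub>M\<^esub> p n i \<in> A i" if "i \<in> I" for i
        using subgroup.m_closed[OF sub[OF that]] pA[OF m that] pA[OF n that] by simp
    qed auto
  qed
  have psame: "p m i = (if i = j then m else \<zero>\<^bsub>M\<^esub>)" if j: "j \<in> I" and m: "m \<in> A j" and i: "i \<in> I" for m i j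
  proof (rule uniq[where T = "{j}"])
    show "finsum M (\<lambda>i. if i = j then m else \<zero>\<^bsub>M\<^esub>) {j} = m"
      using m subc[OF j] M.finsum_insert[of "{}" j "\<lambda>i. if i = j then m else \<zero>\<^bsub>M\<^esub>"] by auto
  qed (use i j m zero in auto)
  have "projections M I A (\<lambda>i m. p m i)"
    unfolding projections_def
    using pA pc padd psame pfin psum by (auto simp: hom_def)
  then show thesis by (rule that)
qed

lemma (in right_module) act_zero_left: "act M \<zero> a = \<zero>"
  using act_add_left[of \<zero> \<zero> a] act_closed[of \<zero> a] by (simp add: add.l_cancel_one')

lemma (in right_module) act_zero_right: "m \<in> carrier M \<Longrightarrow> act M m 0 = \<zero>"
  using act_add_right[of m 0 0] act_closed[of m 0] by (simp add: add.l_cancel_one')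

context groupoid
begin

definition inverse_mor :: "'g \<Rightarrow> 'g"
  where "inverse_mor \<gamma> = (SOME \<delta>. \<delta> \<in> Mor \<Gamma> \<and> src \<Gamma> \<delta> = tgt \<Gamma> \<gamma> \<and> tgt \<Gamma> \<delta> = src \<Gamma> \<gamma>
      \<and> cmp \<Gamma> \<delta> \<gamma> = src \<Gamma> \<gamma> \<and> cmp \<Gamma> \<gamma> \<delta> = tgt \<Gamma> \<gamma>)"

lemma inverse_mor:
  assumes "\<gamma> \<in> Mor \<Gamma>"
  shows "inverse_mor \<gamma> \<in> Mor \<Gamma>" "src \<Gamma> (inverse_mor \<gamma>) = tgt \<Gamma> \<gamma>" "tgt \<Gamma> (inverse_mor \<gamma>) = src \<Gamma> \<gamma>"
    "cmp \<Gamma> (inverse_mor \<gamma>) \<gamma> = src \<Gamma> \<gamma>" "cmp \<Gamma> \<gamma> (inverse_mor \<gamma>) = tgt \<Gamma> \<gamma>"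
  using someI_ex[of "\<lambda>\<delta>. \<delta> \<in> Mor \<Gamma> \<and> src \<Gamma> \<delta> = tgt \<Gamma> \<gamma> \<and> tgt \<Gamma> \<delta> = src \<Gamma> \<gamma>
      \<and> cmp \<Gamma> \<delta> \<gamma> = src \<Gamma> \<gamma> \<and> cmp \<Gamma> \<gamma> \<delta> = tgt \<Gamma> \<gamma>"] invertible[OF assms]
  unfolding inverse_mor_def by blast+

lemma identities_eq: "identities \<Gamma> = src \<Gamma> ` Mor \<Gamma>"
  using src_src src_closed unfolding identities_def by force

end

lemma abelian_group_regular_module: "abelian_group (regular_module R)"
proof (rule abelian_groupI)
  fix x assume "x \<in> carrier (regular_module R)"
  show "\<exists>y\<in>carrier (regular_module R). y \<oplus>\<^bsub>regular_module R\<^esub> x = \<zero>\<^bsub>regular_module R\<^esub>"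
    by (rule bexI[of _ "- x"]) (auto simp: regular_module_def)
qed (auto simp: regular_module_def algebra_simps)

lemma finsum_regular_module:
  assumes "finite S"
  shows "finsum (regular_module R) f S = sum f S"
proof -
  interpret A: abelian_group "regular_module R" by (rule abelian_group_regular_module)
  show ?thesis using assms
  proof (induction S rule: finite_induct)
    case empty
    have "\<zero>\<^bsub>regular_module R\<^esub> = 0" by (simp add: regular_module_def)
    then show ?case by simp
  next
    case (insert x F)
    have "f \<in> F \<rightarrow> carrier (regular_module R)" "f x \<in> carrier (regular_module R)"
      by (auto simp: regular_module_def)
    then have "finsum (regular_module R) f (insert x F) = f x \<oplus>\<^bsub>regular_module R\<^esub> sum f F"
      using A.finsum_insert[OF insert(1,2)] insert(3) by simp
    also have "\<dots> = f x + sum f F" by (simp add: regular_module_def)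
    finally show ?case using insert by simp
  qed
qed

context graded_ring
begin

lemma regular_graded_module: "graded_module \<Gamma> R (regular_module R)"
proof -
  interpret A: abelian_group "regular_module R" by (rule abelian_group_regular_module)
  show ?thesis
    by unfold_locales
      (use ring_direct_sum ring_mult_comp ring_mult_zero unit_right in
        \<open>auto simp: regular_module_def algebra_simps\<close>)
qed

lemma graded_submodule_graded_module:
  assumes "graded_module \<Gamma> R M" "graded_submodule \<Gamma> M N"
  shows "graded_module \<Gamma> R (induced_module M N)"
proof -
  interpret M: graded_module \<Gamma> R M by fact
  have N: "subgroup N (add_monoid M)" and act: "\<And>n a. n \<in> N \<Longrightarrow> act M n a \<in> N"
    and ds: "internal_direct_sum (induced_module M N) (Mor \<Gamma>) (\<lambda>\<gamma>. N \<inter> component M \<gamma>)"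
    using assms(2) by (auto simp: graded_submodule_def)
  have sub: "n \<in> N \<Longrightarrow> n \<in> carrier M" for n using subgroup.subset[OF N] by auto
  interpret A: abelian_group "induced_module M N"
  proof (rule abelian_groupI)
    fix x assume "x \<in> carrier (induced_module M N)"
    then have "x \<in> N" by (simp add: induced_module_def)
    then show "\<exists>y\<in>carrier (induced_module M N). y \<oplus>\<^bsub>induced_module M N\<^esub> x = \<zero>\<^bsub>induced_module M N\<^esub>"
      using subgroup.m_inv_closed[OF N] sub M.l_neg
      by (intro bexI[of _ "\<ominus>\<^bsub>M\<^esub> x"]) (auto simp: induced_module_def a_inv_def)
  qed (use subgroup.m_closed[OF N] subgroup.one_closed[OF N] sub M.a_comm M.a_assoc in
        \<open>auto simp: induced_module_def\<close>)
  show ?thesis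
    by unfold_locales
      (use ds act sub M.act_comp M.act_zero M.act_unit M.act_add_left M.act_add_right M.act_assoc in
        \<open>auto simp: induced_module_def\<close>)
qed

lemma component_props:
  assumes "\<gamma> \<in> Mor \<Gamma>"
  shows "0 \<in> R \<gamma>" "a \<in> R \<gamma> \<Longrightarrow> b \<in> R \<gamma> \<Longrightarrow> a + b \<in> R \<gamma>" "a \<in> R \<gamma> \<Longrightarrow> - a \<in> R \<gamma>"
proof -
  interpret A: abelian_group "regular_module R" by (rule abelian_group_regular_module)
  have s: "subgroup (R \<gamma>) (add_monoid (regular_module R))"
    using ring_direct_sum assms by (auto simp: internal_direct_sum_def)
  show "0 \<in> R \<gamma>" using subgroup.one_closed[OF s] by (simp add: regular_module_def)
  show "a \<in> R \<gamma> \<Longrightarrow> b \<in> R \<gamma> \<Longrightarrow> a + b \<in> R \<gamma>"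
    using subgroup.m_closed[OF s] by (simp add: regular_module_def)
  assume a: "a \<in> R \<gamma>"
  have "\<ominus>\<^bsub>regular_module R\<^esub> a = - a"
    by (rule A.minus_equality) (auto simp: regular_module_def)
  then show "- a \<in> R \<gamma>" using subgroup.m_inv_closed[OF s a] unfolding a_inv_def[symmetric] by simp
qed

definition homogeneous_part :: "'g \<Rightarrow> 'r \<Rightarrow> 'r"
  where "homogeneous_part = (SOME c. projections (regular_module R) (Mor \<Gamma>) R c)"

lemma projections_homogeneous_part: "projections (regular_module R) (Mor \<Gamma>) R homogeneous_part"
  unfolding homogeneous_part_def
  using internal_direct_sum_projections[OF abelian_group_regular_module ring_direct_sum] someI
  by metis

lemma homogeneous_part:
  assumes "\<gamma> \<in> Mor \<Gamma>"
  shows "homogeneous_part \<gamma> a \<in> R \<gamma>"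
    "homogeneous_part \<gamma> (a + b) = homogeneous_part \<gamma> a + homogeneous_part \<gamma> b"
    "a \<in> R \<gamma> \<Longrightarrow> homogeneous_part \<gamma> a = a"
    "\<delta> \<in> Mor \<Gamma> \<Longrightarrow> \<gamma> \<noteq> \<delta> \<Longrightarrow> a \<in> R \<delta> \<Longrightarrow> homogeneous_part \<gamma> a = 0"
  using projections_homogeneous_part assms
  by (auto simp: projections_def hom_def regular_module_def)

lemma homogeneous_part_zero: "\<gamma> \<in> Mor \<Gamma> \<Longrightarrow> homogeneous_part \<gamma> 0 = 0"
  using homogeneous_part(2)[of \<gamma> 0 0] by simp

lemma homogeneous_part_finsum:
  assumes "\<gamma> \<in> Mor \<Gamma>" shows "homogeneous_part \<gamma> (sum f S) = (\<Sum>i\<in>S. homogeneous_part \<gamma> (f i))"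
  by (induction S rule: infinite_finite_induct)
    (simp_all add: homogeneous_part_zero assms homogeneous_part(2))

lemma homogeneous_part_sum:
  "finite {\<gamma>\<in>Mor \<Gamma>. homogeneous_part \<gamma> a \<noteq> 0}"
  "(\<Sum>\<gamma> | \<gamma> \<in> Mor \<Gamma> \<and> homogeneous_part \<gamma> a \<noteq> 0. homogeneous_part \<gamma> a) = a"
proof -
  have *: "finite {i\<in>Mor \<Gamma>. homogeneous_part i a \<noteq> \<zero>\<^bsub>regular_module R\<^esub>} \<and>
      finsum (regular_module R) (\<lambda>i. homogeneous_part i a)
        {i\<in>Mor \<Gamma>. homogeneous_part i a \<noteq> \<zero>\<^bsub>regular_module R\<^esub>} = a"
    using projections_homogeneous_part by (auto simp: projections_def regular_module_def)
  have z: "\<zero>\<^bsub>regular_module R\<^esub> = 0" by (simp add: regular_module_def)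
  show "finite {\<gamma>\<in>Mor \<Gamma>. homogeneous_part \<gamma> a \<noteq> 0}" using * unfolding z by blast
  then show "(\<Sum>\<gamma> | \<gamma> \<in> Mor \<Gamma> \<and> homogeneous_part \<gamma> a \<noteq> 0. homogeneous_part \<gamma> a) = a"
    using * finsum_regular_module[of _ R "\<lambda>\<gamma>. homogeneous_part \<gamma> a"] unfolding z by metis
qed

lemma unit_of:
  assumes "e \<in> identities \<Gamma>"
  shows "unit_of R e \<in> R e" "a \<in> R e \<Longrightarrow> unit_of R e * a = a" "a \<in> R e \<Longrightarrow> a * unit_of R e = a"
proof -
  have "\<exists>!u. u \<in> R e \<and> (\<forall>a\<in>R e. u * a = a \<and> a * u = a)"
    using unit_exists[OF assms] by (metis (no_types, lifting))
  from theI'[OF this]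
  show "unit_of R e \<in> R e" "a \<in> R e \<Longrightarrow> unit_of R e * a = a" "a \<in> R e \<Longrightarrow> a * unit_of R e = a"
    unfolding unit_of_def by auto
qed

lemma src_identities: "\<gamma> \<in> Mor \<Gamma> \<Longrightarrow> src \<Gamma> \<gamma> \<in> identities \<Gamma>"
  by (simp add: identities_def src_closed src_src)

lemma homogeneous_part_unit_zero:
  assumes "e \<in> identities \<Gamma>" "unit_of R e * a = a" "\<gamma> \<in> Mor \<Gamma>" "tgt \<Gamma> \<gamma> \<noteq> e"
  shows "homogeneous_part \<gamma> a = 0"
proof -
  have e: "e \<in> Mor \<Gamma>" "src \<Gamma> e = e" using assms(1) by (auto simp: identities_def)
  let ?S = "{\<gamma>\<in>Mor \<Gamma>. homogeneous_part \<gamma> a \<noteq> 0}"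
  have "a = unit_of R e * (\<Sum>\<delta>\<in>?S. homogeneous_part \<delta> a)"
    using assms(2) homogeneous_part_sum(2)[of a] by simp
  then have "homogeneous_part \<gamma> a
      = homogeneous_part \<gamma> (\<Sum>\<delta>\<in>?S. unit_of R e * homogeneous_part \<delta> a)"
    by (simp add: sum_distrib_left)
  also have "\<dots> = (\<Sum>\<delta>\<in>?S. homogeneous_part \<gamma> (unit_of R e * homogeneous_part \<delta> a))"
    by (rule homogeneous_part_finsum[OF assms(3)])
  also have "\<dots> = 0"
  proof (rule sum.neutral, rule ballI)
    fix \<delta> assume "\<delta> \<in> ?S"
    then have d: "\<delta> \<in> Mor \<Gamma>" by simp
    show "homogeneous_part \<gamma> (unit_of R e * homogeneous_part \<delta> a) = 0"
    proof (cases "tgt \<Gamma> \<delta> = e")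
      case True
      then have "unit_of R e * homogeneous_part \<delta> a = homogeneous_part \<delta> a"
        using unit_left[OF d homogeneous_part(1)[OF d]] by simp
      moreover have "\<gamma> \<noteq> \<delta>" using True assms(4) by auto
      ultimately show ?thesis
        using homogeneous_part(4)[OF assms(3) d _ homogeneous_part(1)[OF d]] by simp
    next
      case False
      then have "unit_of R e * homogeneous_part \<delta> a = 0"
        using ring_mult_zero[OF e(1) d _ unit_of(1)[OF assms(1)] homogeneous_part(1)[OF d]] e by simp
      then show ?thesis by (simp add: homogeneous_part_zero assms(3))
    qed
  qed
  finally show ?thesis .
qed

end

text \<open>
  The graded free module with one basis element of degree \<open>dg p\<close> for each \<open>p \<in> H\<close>, the basis
  element at \<open>p\<close> generating a copy of \<open>1\<^sub>e R\<close> with \<open>e = src \<Gamma> (dg p)\<close>.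
\<close>

locale free_module = graded_ring \<Gamma> R for \<Gamma> :: "'g category" and R :: "'g \<Rightarrow> 'r::ring set" +
  fixes H :: "'p set" and dg :: "'p \<Rightarrow> 'g"
  assumes dg: "p \<in> H \<Longrightarrow> dg p \<in> Mor \<Gamma>"
begin

definition shift :: "'p \<Rightarrow> 'g \<Rightarrow> 'g"
  where "shift p \<sigma> = cmp \<Gamma> (inverse_mor (dg p)) \<sigma>"

definition free_carrier :: "('p \<Rightarrow> 'r) set"
  where "free_carrier = {f. finite {p. f p \<noteq> 0} \<and> (\<forall>p. p \<notin> H \<longrightarrow> f p = 0) \<and>
    (\<forall>p\<in>H. unit_of R (src \<Gamma> (dg p)) * f p = f p)}"

definition free_component :: "'g \<Rightarrow> ('p \<Rightarrow> 'r) set"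
  where "free_component \<sigma> = {f\<in>free_carrier. \<forall>p\<in>H.
    if tgt \<Gamma> \<sigma> = tgt \<Gamma> (dg p) then f p \<in> R (shift p \<sigma>) else f p = 0}"

definition free :: "('g, 'r, 'p \<Rightarrow> 'r) gr_module"
  where "free = \<lparr>carrier = free_carrier, mult = undefined, one = undefined, zero = (\<lambda>p. 0),
    add = (\<lambda>f g p. f p + g p), act = (\<lambda>f a p. f p * a), component = free_component\<rparr>"

lemma free_simps [simp]:
  "carrier free = free_carrier" "zero free = (\<lambda>p. 0)" "add free f g = (\<lambda>p. f p + g p)"
  "act free f a = (\<lambda>p. f p * a)" "component free = free_component"
  by (simp_all add: free_def)

lemma shift:
  assumes "p \<in> H" "\<sigma> \<in> Mor \<Gamma>" "tgt \<Gamma> \<sigma> = tgt \<Gamma> (dg p)"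
  shows "shift p \<sigma> \<in> Mor \<Gamma>" "tgt \<Gamma> (shift p \<sigma>) = src \<Gamma> (dg p)" "src \<Gamma> (shift p \<sigma>) = src \<Gamma> \<sigma>"
    "cmp \<Gamma> (dg p) (shift p \<sigma>) = \<sigma>"
proof -
  note i = inverse_mor[OF dg[OF assms(1)]]
  show "shift p \<sigma> \<in> Mor \<Gamma>" "tgt \<Gamma> (shift p \<sigma>) = src \<Gamma> (dg p)" "src \<Gamma> (shift p \<sigma>) = src \<Gamma> \<sigma>"
    using i assms unfolding shift_def by (simp_all add: cmp_closed tgt_cmp src_cmp)
  have "cmp \<Gamma> (dg p) (shift p \<sigma>) = cmp \<Gamma> (cmp \<Gamma> (dg p) (inverse_mor (dg p))) \<sigma>"
    unfolding shift_def using i assms dg by (intro cmp_assoc[symmetric]) auto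
  then show "cmp \<Gamma> (dg p) (shift p \<sigma>) = \<sigma>" using i assms cmp_tgt[of \<sigma>] by simp
qed

lemma shift_cmp:
  assumes "p \<in> H" "\<sigma> \<in> Mor \<Gamma>" "\<tau> \<in> Mor \<Gamma>" "tgt \<Gamma> \<sigma> = tgt \<Gamma> (dg p)" "src \<Gamma> \<sigma> = tgt \<Gamma> \<tau>"
  shows "shift p (cmp \<Gamma> \<sigma> \<tau>) = cmp \<Gamma> (shift p \<sigma>) \<tau>"
  unfolding shift_def using inverse_mor[OF dg[OF assms(1)]] assms
  by (intro cmp_assoc[symmetric]) auto

lemma shift_dg:
  assumes "p \<in> H" "\<tau> \<in> Mor \<Gamma>" "tgt \<Gamma> \<tau> = src \<Gamma> (dg p)"
  shows "shift p (cmp \<Gamma> (dg p) \<tau>) = \<tau>"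
proof -
  note i = inverse_mor[OF dg[OF assms(1)]]
  have "shift p (cmp \<Gamma> (dg p) \<tau>) = cmp \<Gamma> (cmp \<Gamma> (inverse_mor (dg p)) (dg p)) \<tau>"
    unfolding shift_def using i assms dg by (intro cmp_assoc[symmetric]) auto
  then show ?thesis using i assms cmp_tgt[of \<tau>] by simp
qed

lemma free_carrier_closed:
  assumes "f \<in> free_carrier"
  shows "g \<in> free_carrier \<Longrightarrow> (\<lambda>p. f p + g p) \<in> free_carrier"
    "(\<lambda>p. - f p) \<in> free_carrier" "(\<lambda>p. f p * a) \<in> free_carrier"
proof -
  have fin: "finite {p. f p \<noteq> 0}" using assms by (simp add: free_carrier_def)
  show "(\<lambda>p. - f p) \<in> free_carrier" using assms by (simp add: free_carrier_def)
  have "finite {p. f p * a \<noteq> 0}" by (rule finite_subset[OF _ fin]) auto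
  then show "(\<lambda>p. f p * a) \<in> free_carrier"
    using assms by (auto simp: free_carrier_def mult.assoc[symmetric])
  assume g: "g \<in> free_carrier"
  then have "finite {p. g p \<noteq> 0}" by (simp add: free_carrier_def)
  with fin have "finite ({p. f p \<noteq> 0} \<union> {p. g p \<noteq> 0})" by simp
  then have "finite {p. f p + g p \<noteq> 0}" by (rule finite_subset[rotated]) auto
  then show "(\<lambda>p. f p + g p) \<in> free_carrier"
    using assms g by (auto simp: free_carrier_def distrib_left)
qed

lemma free_abelian_group: "abelian_group free"
proof (rule abelian_groupI)
  fix f assume "f \<in> carrier free"
  then show "\<exists>y\<in>carrier free. y \<oplus>\<^bsub>free\<^esub> f = \<zero>\<^bsub>free\<^esub>"
    using free_carrier_closed(2) by (intro bexI[of _ "\<lambda>p. - f p"]) auto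
qed (use free_carrier_closed in \<open>auto simp: algebra_simps\<close>, auto simp: free_carrier_def)

sublocale F: abelian_group free by (rule free_abelian_group)

lemma free_inv: "f \<in> free_carrier \<Longrightarrow> \<ominus>\<^bsub>free\<^esub> f = (\<lambda>p. - f p)"
  using free_carrier_closed(2) by (intro F.minus_equality) auto

lemma free_finsum:
  assumes "finite S" "f \<in> S \<rightarrow> free_carrier"
  shows "finsum free f S p = (\<Sum>i\<in>S. f i p)"
  using assms
proof (induction S rule: finite_induct)
  case (insert x S)
  then have "f \<in> S \<rightarrow> carrier free" "f x \<in> carrier free" by auto
  then show ?case using insert by simp
qed simp

lemma free_component_subgroup:
  assumes "\<sigma> \<in> Mor \<Gamma>"
  shows "subgroup (free_component \<sigma>) (add_monoid free)"
proof (rule group.subgroupI)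
  show "group (add_monoid free)" by (rule F.a_group)
  show "free_component \<sigma> \<subseteq> carrier (add_monoid free)" by (auto simp: free_component_def)
  have "(\<lambda>p. 0) \<in> free_component \<sigma>"
    using shift(1)[OF _ assms] component_props by (auto simp: free_component_def free_carrier_def)
  then show "free_component \<sigma> \<noteq> {}" by auto
next
  fix f assume f: "f \<in> free_component \<sigma>"
  then have "f \<in> free_carrier" by (simp add: free_component_def)
  moreover have "(\<lambda>p. - f p) \<in> free_component \<sigma>"
    using f free_carrier_closed(2) shift(1)[OF _ assms] component_props(3)
    by (auto simp: free_component_def)
  ultimately show "inv\<^bsub>add_monoid free\<^esub> f \<in> free_component \<sigma>"
    using free_inv[of f] by (simp add: a_inv_def)
next
  fix f g assume "f \<in> free_component \<sigma>" "g \<in> free_component \<sigma>"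
  then show "f \<otimes>\<^bsub>add_monoid free\<^esub> g \<in> free_component \<sigma>"
    using free_carrier_closed(1) shift(1)[OF _ assms] component_props(2)
    by (auto simp: free_component_def)
qed

definition free_proj :: "'g \<Rightarrow> ('p \<Rightarrow> 'r) \<Rightarrow> ('p \<Rightarrow> 'r)"
  where "free_proj \<sigma> f = (\<lambda>p. if p \<in> H \<and> tgt \<Gamma> \<sigma> = tgt \<Gamma> (dg p)
    then homogeneous_part (shift p \<sigma>) (f p) else 0)"

lemma free_proj_component:
  assumes s: "\<sigma> \<in> Mor \<Gamma>" and f: "f \<in> free_carrier"
  shows "free_proj \<sigma> f \<in> free_component \<sigma>"
proof -
  have "{p. free_proj \<sigma> f p \<noteq> 0} \<subseteq> {p. f p \<noteq> 0}"
    using shift(1)[OF _ s] by (auto simp: free_proj_def homogeneous_part_zero split: if_splits)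
  then have "finite {p. free_proj \<sigma> f p \<noteq> 0}"
    using f by (auto simp: free_carrier_def intro: finite_subset)
  moreover have "unit_of R (src \<Gamma> (dg p)) * free_proj \<sigma> f p = free_proj \<sigma> f p" if "p \<in> H" for p
    using shift[OF that s] unit_left[of "shift p \<sigma>"] homogeneous_part(1)
    by (auto simp: free_proj_def)
  ultimately have "free_proj \<sigma> f \<in> free_carrier"
    by (auto simp: free_carrier_def) (auto simp: free_proj_def)
  moreover have "free_proj \<sigma> f p \<in> R (shift p \<sigma>)" if "p \<in> H" "tgt \<Gamma> \<sigma> = tgt \<Gamma> (dg p)" for p
    using that homogeneous_part(1) shift(1)[OF that(1) s that(2)] by (auto simp: free_proj_def)
  ultimately show ?thesis by (auto simp: free_component_def) (auto simp: free_proj_def)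
qed

lemma free_proj_same:
  assumes s: "\<sigma> \<in> Mor \<Gamma>" and f: "f \<in> free_component \<sigma>"
  shows "free_proj \<sigma> f = f"
proof
  fix p show "free_proj \<sigma> f p = f p"
    using f shift(1)[OF _ s] homogeneous_part(3)
    by (cases "p \<in> H") (auto simp: free_proj_def free_component_def free_carrier_def)
qed

lemma free_proj_diff:
  assumes s: "\<sigma> \<in> Mor \<Gamma>" and t: "\<tau> \<in> Mor \<Gamma>" and ne: "\<sigma> \<noteq> \<tau>" and f: "f \<in> free_component \<tau>"
  shows "free_proj \<sigma> f = (\<lambda>p. 0)"
proof
  fix p show "free_proj \<sigma> f p = 0"
  proof (cases "p \<in> H \<and> tgt \<Gamma> \<sigma> = tgt \<Gamma> (dg p)")
    case True
    show ?thesis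
    proof (cases "tgt \<Gamma> \<tau> = tgt \<Gamma> (dg p)")
      case t': True
      have "shift p \<sigma> \<noteq> shift p \<tau>" using shift(4)[of p \<sigma>] shift(4)[of p \<tau>] True t' s t ne by metis
      moreover have "f p \<in> R (shift p \<tau>)" using True t' f by (auto simp: free_component_def)
      ultimately have "homogeneous_part (shift p \<sigma>) (f p) = 0"
        using True t' shift(1) s t by (intro homogeneous_part(4)) auto
      then show ?thesis by (simp add: free_proj_def)
    next
      case False
      then show ?thesis using True f s shift(1)
        by (auto simp: free_proj_def free_component_def homogeneous_part_zero)
    qed
  qed (auto simp: free_proj_def)
qed

lemma free_proj_pointwise:
  assumes f: "f \<in> free_carrier" and p: "p \<in> H"
  shows "finite {\<sigma>\<in>Mor \<Gamma>. free_proj \<sigma> f p \<noteq> 0}"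
    "(\<Sum>\<sigma> | \<sigma> \<in> Mor \<Gamma> \<and> free_proj \<sigma> f p \<noteq> 0. free_proj \<sigma> f p) = f p"
proof -
  let ?T = "{\<tau>\<in>Mor \<Gamma>. homogeneous_part \<tau> (f p) \<noteq> 0}"
  let ?S = "{\<sigma>\<in>Mor \<Gamma>. free_proj \<sigma> f p \<noteq> 0}"
  have T: "tgt \<Gamma> \<tau> = src \<Gamma> (dg p)" if "\<tau> \<in> ?T" for \<tau>
    using homogeneous_part_unit_zero[OF src_identities[OF dg[OF p]], of "f p" \<tau>] f p that
    by (auto simp: free_carrier_def)
  have S: "tgt \<Gamma> \<sigma> = tgt \<Gamma> (dg p)" if "\<sigma> \<in> ?S" for \<sigma>
    using that by (auto simp: free_proj_def split: if_splits)
  have eq: "free_proj \<sigma> f p = homogeneous_part (shift p \<sigma>) (f p)" if "\<sigma> \<in> ?S" for \<sigma>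
    using S[OF that] p by (simp add: free_proj_def)
  have T': "cmp \<Gamma> (dg p) \<tau> \<in> ?S" if "\<tau> \<in> ?T" for \<tau>
    using that T[OF that] p dg[OF p] shift_dg[OF p]
    by (auto simp: cmp_closed tgt_cmp free_proj_def)
  have S': "shift p \<sigma> \<in> ?T" if "\<sigma> \<in> ?S" for \<sigma>
    using that S[OF that] eq[OF that] shift(1)[OF p] by auto
  have bij: "bij_betw (shift p) ?S ?T"
    by (rule bij_betw_byWitness[where f' = "cmp \<Gamma> (dg p)"])
      (use T T' S S' shift(4)[OF p] shift_dg[OF p] in auto)
  show "finite ?S" using bij_betw_finite[OF bij] homogeneous_part_sum(1) by simp
  have "(\<Sum>\<sigma>\<in>?S. free_proj \<sigma> f p) = (\<Sum>\<sigma>\<in>?S. homogeneous_part (shift p \<sigma>) (f p))"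
    by (rule sum.cong[OF refl]) (rule eq)
  also have "\<dots> = (\<Sum>\<tau>\<in>?T. homogeneous_part \<tau> (f p))"
    by (rule sum.reindex_bij_betw[OF bij])
  also have "\<dots> = f p" by (rule homogeneous_part_sum(2))
  finally show "(\<Sum>\<sigma>\<in>?S. free_proj \<sigma> f p) = f p" .
qed

lemma free_proj_sum:
  assumes f: "f \<in> free_carrier"
  shows "finite {\<sigma>\<in>Mor \<Gamma>. free_proj \<sigma> f \<noteq> (\<lambda>p. 0)}"
    "finsum free (\<lambda>\<sigma>. free_proj \<sigma> f) {\<sigma>\<in>Mor \<Gamma>. free_proj \<sigma> f \<noteq> (\<lambda>p. 0)} = f"
proof -
  let ?S = "{\<sigma>\<in>Mor \<Gamma>. free_proj \<sigma> f \<noteq> (\<lambda>p. 0)}"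
  have nz: "p \<in> H \<and> f p \<noteq> 0" if "\<sigma> \<in> Mor \<Gamma>" "free_proj \<sigma> f p \<noteq> 0" for \<sigma> p
    using that shift(1) by (auto simp: free_proj_def homogeneous_part_zero split: if_splits)
  have "?S \<subseteq> (\<Union>p\<in>{p. f p \<noteq> 0} \<inter> H. {\<sigma>\<in>Mor \<Gamma>. free_proj \<sigma> f p \<noteq> 0})"
    using nz by (auto simp: fun_eq_iff)
  moreover have "finite ({p. f p \<noteq> 0} \<inter> H)" using f by (simp add: free_carrier_def)
  ultimately show fin: "finite ?S"
    using free_proj_pointwise(1)[OF f] by (auto intro: finite_subset)
  show "finsum free (\<lambda>\<sigma>. free_proj \<sigma> f) ?S = f"
  proof
    fix p
    have "finsum free (\<lambda>\<sigma>. free_proj \<sigma> f) ?S p = (\<Sum>\<sigma>\<in>?S. free_proj \<sigma> f p)"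
      using free_proj_component[OF _ f] by (intro free_finsum[OF fin]) (auto simp: free_component_def)
    also have "\<dots> = (\<Sum>\<sigma> | \<sigma> \<in> Mor \<Gamma> \<and> free_proj \<sigma> f p \<noteq> 0. free_proj \<sigma> f p)"
      using fin by (intro sum.mono_neutral_right) (auto simp: fun_eq_iff)
    also have "\<dots> = f p"
    proof (cases "p \<in> H")
      case True then show ?thesis by (rule free_proj_pointwise(2)[OF f])
    next
      case False then show ?thesis using f by (simp add: free_carrier_def free_proj_def)
    qed
    finally show "finsum free (\<lambda>\<sigma>. free_proj \<sigma> f) ?S p = f p" .
  qed
qed

lemma free_graded_module: "graded_module \<Gamma> R free"
proof unfold_locales
  have "projections free (Mor \<Gamma>) free_component free_proj"
  proof -
    have "free_proj \<sigma> \<in> hom (add_monoid free) (add_monoid free)" if s: "\<sigma> \<in> Mor \<Gamma>" for \<sigma>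
      using free_proj_component[OF s] shift(1)[OF _ s] homogeneous_part(2)
      by (auto simp: hom_def free_component_def) (auto simp: free_proj_def fun_eq_iff)
    then show ?thesis
      using free_proj_component free_proj_same free_proj_diff free_proj_sum
      by (auto simp: projections_def)
  qed
  then show "internal_direct_sum free (Mor \<Gamma>) (component free)"
    using internal_direct_sumI[OF free_abelian_group free_component_subgroup] by simp
next
  fix \<sigma> \<tau> f a assume *: "\<sigma> \<in> Mor \<Gamma>" "\<tau> \<in> Mor \<Gamma>" "src \<Gamma> \<sigma> = tgt \<Gamma> \<tau>" "f \<in> component free \<sigma>" "a \<in> R \<tau>"
  have "f p * a \<in> R (shift p (cmp \<Gamma> \<sigma> \<tau>))" if "p \<in> H" "tgt \<Gamma> \<sigma> = tgt \<Gamma> (dg p)" for p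
    unfolding shift_cmp[OF that(1) *(1,2) that(2) *(3)]
    using * that shift[OF that(1) *(1) that(2)]
    by (intro ring_mult_comp) (auto simp: free_component_def)
  then show "act free f a \<in> component free (cmp \<Gamma> \<sigma> \<tau>)"
    using * free_carrier_closed(3)[of f a] by (auto simp: free_component_def tgt_cmp)
next
  fix \<sigma> \<tau> f a assume *: "\<sigma> \<in> Mor \<Gamma>" "\<tau> \<in> Mor \<Gamma>" "src \<Gamma> \<sigma> \<noteq> tgt \<Gamma> \<tau>" "f \<in> component free \<sigma>" "a \<in> R \<tau>"
  have "f p * a = 0" for p
  proof (cases "p \<in> H \<and> tgt \<Gamma> \<sigma> = tgt \<Gamma> (dg p)")
    case True
    then show ?thesis using * shift[of p \<sigma>]
      by (intro ring_mult_zero[of "shift p \<sigma>" \<tau>]) (auto simp: free_component_def)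
  next
    case False
    then have "f p = 0" using * by (cases "p \<in> H") (auto simp: free_component_def free_carrier_def)
    then show ?thesis by simp
  qed
  then show "act free f a = \<zero>\<^bsub>free\<^esub>" by simp
next
  fix \<sigma> f assume *: "\<sigma> \<in> Mor \<Gamma>" "f \<in> component free \<sigma>"
  have "f p * unit_of R (src \<Gamma> \<sigma>) = f p" for p
  proof (cases "p \<in> H \<and> tgt \<Gamma> \<sigma> = tgt \<Gamma> (dg p)")
    case True
    then show ?thesis using * shift[of p \<sigma>] unit_right[of "shift p \<sigma>" "f p"]
      by (auto simp: free_component_def)
  next
    case False
    then have "f p = 0" using * by (cases "p \<in> H") (auto simp: free_component_def free_carrier_def)
    then show ?thesis by simp
  qed
  then show "act free f (unit_of R (src \<Gamma> \<sigma>)) = f" by simp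
qed (use free_carrier_closed in \<open>auto simp: algebra_simps\<close>)

definition free_map :: "('g, 'r, 'm) gr_module \<Rightarrow> ('p \<Rightarrow> 'm) \<Rightarrow> ('p \<Rightarrow> 'r) \<Rightarrow> 'm"
  where "free_map X x f = finsum X (\<lambda>p. act X (x p) (f p)) {p. f p \<noteq> 0}"

lemma free_map_hom:
  fixes X :: "('g, 'r, 'm) gr_module"
  assumes X: "graded_module \<Gamma> R X" and xc: "\<And>p. x p \<in> carrier X"
    and x: "\<And>p. p \<in> H \<Longrightarrow> x p \<in> component X (dg p)"
  shows "free_map X x \<in> gr_hom \<Gamma> free X"
proof -
  interpret X: graded_module \<Gamma> R X by fact
  have fin: "finite {p. f p \<noteq> 0}" if "f \<in> free_carrier" for f
    using that by (simp add: free_carrier_def)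
  have eq: "free_map X x f = finsum X (\<lambda>p. act X (x p) (f p)) T"
    if "finite T" "{p. f p \<noteq> 0} \<subseteq> T" for f T
    unfolding free_map_def using that xc
    by (intro X.finsum_neutral) (auto simp: X.act_zero_right X.act_closed)
  have cl: "free_map X x f \<in> carrier X" for f
    unfolding free_map_def using xc by (intro X.finsum_closed) (auto simp: X.act_closed)
  have add: "free_map X x (\<lambda>p. f p + g p) = free_map X x f \<oplus>\<^bsub>X\<^esub> free_map X x g"
    if f: "f \<in> free_carrier" and g: "g \<in> free_carrier" for f g
  proof -
    let ?T = "{p. f p \<noteq> 0} \<union> {p. g p \<noteq> 0}"
    have T: "finite ?T" using fin f g by simp
    have "free_map X x (\<lambda>p. f p + g p) = finsum X (\<lambda>p. act X (x p) (f p + g p)) ?T"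
      by (rule eq[OF T]) auto
    also have "\<dots> = finsum X (\<lambda>p. act X (x p) (f p) \<oplus>\<^bsub>X\<^esub> act X (x p) (g p)) ?T"
      using xc by (intro X.finsum_cong') (auto simp: X.act_add_right X.act_closed)
    also have "\<dots> = finsum X (\<lambda>p. act X (x p) (f p)) ?T \<oplus>\<^bsub>X\<^esub> finsum X (\<lambda>p. act X (x p) (g p)) ?T"
      using xc by (intro X.finsum_addf) (auto simp: X.act_closed)
    also have "\<dots> = free_map X x f \<oplus>\<^bsub>X\<^esub> free_map X x g"
      using eq[OF T, of f] eq[OF T, of g] by simp
    finally show ?thesis .
  qed
  have act: "free_map X x (\<lambda>p. f p * a) = act X (free_map X x f) a" if f: "f \<in> free_carrier" for f a
  proof -
    have h: "(\<lambda>m. act X m a) \<in> hom (add_monoid X) (add_monoid X)"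
      by (auto simp: hom_def X.act_closed X.act_add_left)
    have "free_map X x (\<lambda>p. f p * a) = finsum X (\<lambda>p. act X (x p) (f p * a)) {p. f p \<noteq> 0}"
      by (rule eq[OF fin[OF f]]) auto
    also have "\<dots> = finsum X (\<lambda>p. act X (act X (x p) (f p)) a) {p. f p \<noteq> 0}"
      using xc by (intro X.finsum_cong') (auto simp: X.act_assoc X.act_closed)
    also have "\<dots> = act X (free_map X x f) a"
      unfolding free_map_def using xc
      by (intro finsum_additive[OF X.abelian_group_axioms X.abelian_group_axioms h fin[OF f], symmetric])
        (auto simp: X.act_closed)
    finally show ?thesis .
  qed
  have grad: "free_map X x f \<in> component X \<sigma>" if s: "\<sigma> \<in> Mor \<Gamma>" and f: "f \<in> free_component \<sigma>" for f \<sigma>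
    unfolding free_map_def
  proof (rule add_subgroup_finsum[OF X.abelian_group_axioms])
    show sg: "subgroup (component X \<sigma>) (add_monoid X)"
      using X.module_direct_sum s by (simp add: internal_direct_sum_def)
    show "finite {p. f p \<noteq> 0}" using f fin by (simp add: free_component_def)
    fix p assume p: "p \<in> {p. f p \<noteq> 0}"
    then have pH: "p \<in> H" using f by (auto simp: free_component_def free_carrier_def)
    then have t: "tgt \<Gamma> \<sigma> = tgt \<Gamma> (dg p)" "f p \<in> R (shift p \<sigma>)"
      using p f by (auto simp: free_component_def split: if_splits)
    show "act X (x p) (f p) \<in> component X \<sigma>"
      using X.act_comp[OF dg[OF pH] shift(1)[OF pH s t(1)] _ x[OF pH] t(2)] shift[OF pH s t(1)] by simp
  qed
  show ?thesis using cl add act grad by (auto simp: gr_hom_def hom_def)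
qed

end

theorem gr_projective_lifts_along:
  fixes \<Gamma> :: "'g category" and R :: "'g \<Rightarrow> 'r::ring set"
    and P :: "('g, 'r, 'p) gr_module" and M :: "('g, 'r, 'm) gr_module" and N :: "('g, 'r, 'n) gr_module"
  assumes "graded_ring \<Gamma> R" "gr_projective \<Gamma> R P" "graded_module \<Gamma> R M" "graded_module \<Gamma> R N"
  shows "lifts_along \<Gamma> P M N"
  unfolding lifts_along_def
proof (intro ballI impI)
  fix g h assume g: "g \<in> gr_hom \<Gamma> M N" and h: "h \<in> gr_hom \<Gamma> P N" and surj: "g ` carrier M = carrier N"
  interpret graded_ring \<Gamma> R by fact
  interpret M: graded_module \<Gamma> R M by fact
  interpret N: graded_module \<Gamma> R N by fact
  interpret P: graded_module \<Gamma> R P using assms(2) by (simp add: gr_projective_def)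
  note ags = M.abelian_group_axioms N.abelian_group_axioms P.abelian_group_axioms
  define H where "H = (\<Union>\<gamma>\<in>Mor \<Gamma>. component P \<gamma>)"
  define dg where "dg p = (SOME \<gamma>. \<gamma> \<in> Mor \<Gamma> \<and> p \<in> component P \<gamma>)" for p
  have dgp: "dg p \<in> Mor \<Gamma> \<and> p \<in> component P (dg p)" if "p \<in> H" for p
    unfolding dg_def by (rule someI_ex) (use that in \<open>auto simp: H_def\<close>)
  interpret free_module \<Gamma> R H dg by unfold_locales (use dgp in auto)
  have subP: "component P \<gamma> \<subseteq> carrier P" if "\<gamma> \<in> Mor \<Gamma>" for \<gamma>
    using P.module_direct_sum that subgroup.subset by (fastforce simp: internal_direct_sum_def)
  have HP: "H \<subseteq> carrier P" unfolding H_def using subP by auto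

  define \<iota> where "\<iota> p = (if p \<in> H then p else \<zero>\<^bsub>P\<^esub>)" for p
  let ?\<pi> = "free_map P \<iota>"
  have \<pi>: "?\<pi> \<in> gr_hom \<Gamma> free P"
    by (rule free_map_hom[OF P.graded_module_axioms]) (use HP dgp in \<open>auto simp: \<iota>_def\<close>)
  have \<pi>hom: "?\<pi> \<in> hom (add_monoid free) (add_monoid P)" using \<pi> by (simp add: gr_hom_def)
  have homog: "\<exists>f\<in>free_carrier. ?\<pi> f = p" if p: "p \<in> H" for p
  proof -
    let ?u = "unit_of R (src \<Gamma> (dg p))"
    let ?f = "\<lambda>q. if q = p then ?u else 0"
    have e: "src \<Gamma> (dg p) \<in> identities \<Gamma>" using src_identities dgp[OF p] by simp
    have s: "{q. ?f q \<noteq> 0} \<subseteq> {p}" by auto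
    then have f: "?f \<in> free_carrier"
      using p unit_of(2)[OF e unit_of(1)[OF e]] finite_subset[OF s] by (auto simp: free_carrier_def)
    have ac: "act P p ?u = p" using P.act_unit dgp[OF p] by simp
    have "?\<pi> ?f = finsum P (\<lambda>q. act P (\<iota> q) (?f q)) {p}"
      unfolding free_map_def using s p HP
      by (intro P.finsum_neutral) (auto simp: P.act_zero_right P.act_closed \<iota>_def)
    also have "\<dots> = p"
      using ac p HP P.finsum_insert[of "{}" p "\<lambda>q. act P (\<iota> q) (?f q)"] by (auto simp: \<iota>_def)
    finally show ?thesis using f by blast
  qed
  have \<pi>surj: "?\<pi> ` carrier free = carrier P"
  proof
    show "?\<pi> ` carrier free \<subseteq> carrier P" using \<pi>hom by (auto simp: hom_def)
    show "carrier P \<subseteq> ?\<pi> ` carrier free"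
    proof
      fix m assume m: "m \<in> carrier P"
      obtain pr where pr: "projections P (Mor \<Gamma>) (component P) pr"
        using internal_direct_sum_projections[OF ags(3) P.module_direct_sum] by blast
      let ?S = "{i\<in>Mor \<Gamma>. pr i m \<noteq> \<zero>\<^bsub>P\<^esub>}"
      have S: "finite ?S" "finsum P (\<lambda>i. pr i m) ?S = m" using pr m by (auto simp: projections_def)
      have "pr i m \<in> H" if "i \<in> Mor \<Gamma>" for i
        using pr m that by (auto simp: H_def projections_def)
      then have "\<forall>i\<in>Mor \<Gamma>. \<exists>f\<in>free_carrier. ?\<pi> f = pr i m" using homog by blast
      then obtain F where F: "\<And>i. i \<in> Mor \<Gamma> \<Longrightarrow> F i \<in> free_carrier" "\<And>i. i \<in> Mor \<Gamma> \<Longrightarrow> ?\<pi> (F i) = pr i m"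
        by metis
      have "?\<pi> (finsum free F ?S) = finsum P (\<lambda>i. ?\<pi> (F i)) ?S"
        using F by (intro finsum_additive[OF free_abelian_group ags(3) \<pi>hom S(1)]) auto
      also have "\<dots> = finsum P (\<lambda>i. pr i m) ?S"
        using F pr m subP by (intro P.finsum_cong') (fastforce simp: projections_def)+
      finally have "?\<pi> (finsum free F ?S) = m" using S by simp
      moreover have "finsum free F ?S \<in> carrier free" using F by (intro F.finsum_closed) auto
      ultimately show "m \<in> ?\<pi> ` carrier free" by force
    qed
  qed
  have "(\<lambda>x. x) \<in> gr_hom \<Gamma> P P" by (auto simp: gr_hom_def hom_def)
  moreover have "lifts_along \<Gamma> P free P"
    using assms(2) free_graded_module P.graded_module_axioms by (simp add: gr_projective_def)
  ultimately obtain s where s: "s \<in> gr_hom \<Gamma> P free" "\<And>x. x \<in> carrier P \<Longrightarrow> ?\<pi> (s x) = x"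
    using \<pi> \<pi>surj unfolding lifts_along_def by fast

  have ghom: "g \<in> hom (add_monoid M) (add_monoid N)" and hhom: "h \<in> hom (add_monoid P) (add_monoid N)"
    using g h by (auto simp: gr_hom_def)
  have ex: "\<exists>m. m \<in> component M (dg p) \<and> g m = h p" if p: "p \<in> H" for p
  proof -
    let ?\<gamma> = "dg p"
    have \<gamma>: "?\<gamma> \<in> Mor \<Gamma>" using dgp[OF p] by simp
    have hp: "h p \<in> component N ?\<gamma>" using h dgp[OF p] by (fastforce simp: gr_hom_def)
    have "h p \<in> carrier N" using hhom p HP by (auto simp: hom_def)
    then obtain m where m: "m \<in> carrier M" "g m = h p" using surj by (metis imageE)
    obtain a where a: "projections M (Mor \<Gamma>) (component M) a"
      using internal_direct_sum_projections[OF ags(1) M.module_direct_sum] by blast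
    obtain b where b: "projections N (Mor \<Gamma>) (component N) b"
      using internal_direct_sum_projections[OF ags(2) N.module_direct_sum] by blast
    have subM: "component M \<gamma> \<subseteq> carrier M" if "\<gamma> \<in> Mor \<Gamma>" for \<gamma>
      using M.module_direct_sum that subgroup.subset by (fastforce simp: internal_direct_sum_def)
    have subN: "component N \<gamma> \<subseteq> carrier N" if "\<gamma> \<in> Mor \<Gamma>" for \<gamma>
      using N.module_direct_sum that subgroup.subset by (fastforce simp: internal_direct_sum_def)
    let ?S = "insert ?\<gamma> {i\<in>Mor \<Gamma>. a i m \<noteq> \<zero>\<^bsub>M\<^esub>}"
    have aM: "a i m \<in> component M i" if "i \<in> Mor \<Gamma>" for i using a m that by (auto simp: projections_def)
    have aMc: "a i m \<in> carrier M" if "i \<in> Mor \<Gamma>" for i using aM[OF that] subM[OF that] by auto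
    have ga: "g (a i m) \<in> component N i" if "i \<in> Mor \<Gamma>" for i
      using g aM[OF that] that by (fastforce simp: gr_hom_def)
    have gac: "g (a i m) \<in> carrier N" if "i \<in> Mor \<Gamma>" for i using ga[OF that] subN[OF that] by auto
    have S: "finite ?S" using a m by (auto simp: projections_def)
    have "finsum M (\<lambda>i. a i m) {i\<in>Mor \<Gamma>. a i m \<noteq> \<zero>\<^bsub>M\<^esub>} = finsum M (\<lambda>i. a i m) ?S"
      using S aMc \<gamma> by (intro M.finsum_neutral) auto
    then have mS: "m = finsum M (\<lambda>i. a i m) ?S" using a m by (auto simp: projections_def)
    have bh: "b ?\<gamma> \<in> hom (add_monoid N) (add_monoid N)" using b \<gamma> by (auto simp: projections_def)
    have "h p = b ?\<gamma> (h p)" using b hp \<gamma> by (auto simp: projections_def)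
    also have "\<dots> = b ?\<gamma> (g (finsum M (\<lambda>i. a i m) ?S))" using m mS by simp
    also have "\<dots> = b ?\<gamma> (finsum N (\<lambda>i. g (a i m)) ?S)"
      using aMc \<gamma> finsum_additive[OF ags(1,2) ghom S, of "\<lambda>i. a i m"] by auto
    also have "\<dots> = finsum N (\<lambda>i. b ?\<gamma> (g (a i m))) ?S"
      using gac \<gamma> by (intro finsum_additive[OF ags(2,2) bh S]) auto
    also have "\<dots> = finsum N (\<lambda>i. if ?\<gamma> = i then g (a i m) else \<zero>\<^bsub>N\<^esub>) ?S"
      using b ga gac \<gamma> by (intro N.finsum_cong') (auto simp: projections_def)
    also have "\<dots> = g (a ?\<gamma> m)" using S gac \<gamma> by (intro N.finsum_singleton) auto
    finally show ?thesis using aM[OF \<gamma>] by auto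
  qed
  define x where "x p = (if p \<in> H then SOME m. m \<in> component M (dg p) \<and> g m = h p else \<zero>\<^bsub>M\<^esub>)" for p
  have x: "x p \<in> component M (dg p)" "g (x p) = h p" if "p \<in> H" for p
    using someI_ex[OF ex[OF that]] that by (auto simp: x_def)
  have xc: "x p \<in> carrier M" for p
  proof (cases "p \<in> H")
    case True
    then have "subgroup (component M (dg p)) (add_monoid M)"
      using M.module_direct_sum dg by (simp add: internal_direct_sum_def)
    then show ?thesis using x(1)[OF True] subgroup.subset by fastforce
  qed (simp add: x_def)
  have g0: "g \<zero>\<^bsub>M\<^esub> = \<zero>\<^bsub>N\<^esub>" by (rule hom_additive_zero[OF ags(1,2) ghom])
  have h0: "h \<zero>\<^bsub>P\<^esub> = \<zero>\<^bsub>N\<^esub>" by (rule hom_additive_zero[OF ags(3,2) hhom])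
  have gx: "g (x p) = h (\<iota> p)" for p using x(2) g0 h0 by (auto simp: \<iota>_def) (simp add: x_def)
  have \<iota>c: "\<iota> p \<in> carrier P" for p using HP by (auto simp: \<iota>_def)
  let ?k = "free_map M x"
  have k: "?k \<in> gr_hom \<Gamma> free M" by (rule free_map_hom[OF M.graded_module_axioms xc x(1)])
  have gk: "g (?k f) = h (?\<pi> f)" if f: "f \<in> free_carrier" for f
  proof -
    have fin: "finite {p. f p \<noteq> 0}" using f by (simp add: free_carrier_def)
    have hc: "h m \<in> carrier N" if "m \<in> carrier P" for m using hhom that by (auto simp: hom_def)
    have "g (?k f) = finsum N (\<lambda>p. g (act M (x p) (f p))) {p. f p \<noteq> 0}"
      unfolding free_map_def using xc
      by (intro finsum_additive[OF ags(1,2) ghom fin]) (auto simp: M.act_closed)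
    also have "\<dots> = finsum N (\<lambda>p. h (act P (\<iota> p) (f p))) {p. f p \<noteq> 0}"
      using g h xc \<iota>c hc
      by (intro N.finsum_cong') (auto simp: gr_hom_def gx P.act_closed N.act_closed)
    also have "\<dots> = h (?\<pi> f)"
      unfolding free_map_def using \<iota>c
      by (intro finsum_additive[OF ags(3,2) hhom fin, symmetric]) (auto simp: P.act_closed)
    finally show ?thesis .
  qed
  show "\<exists>h'\<in>gr_hom \<Gamma> P M. \<forall>y\<in>carrier P. g (h' y) = h y"
  proof (intro bexI[of _ "\<lambda>y. ?k (s y)"] ballI)
    have sc: "s y \<in> free_carrier" if "y \<in> carrier P" for y
      using s(1) that by (auto simp: gr_hom_def hom_def)
    show "g (?k (s y)) = h y" if "y \<in> carrier P" for y using gk[OF sc[OF that]] s(2)[OF that] by simp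
    show "(\<lambda>y. ?k (s y)) \<in> gr_hom \<Gamma> P M"
      using s(1) k sc by (fastforce simp: gr_hom_def hom_def image_subset_iff)
  qed
qed

end

theory Submission
  imports Defs
begin

text \<open>
  Let \<open>I\<^sub>0 \<subseteq> I\<^sub>1 \<subseteq> \<dots>\<close> be a strictly increasing chain of graded right ideals in \<open>1\<^sub>eR\<close> and
  let \<open>N\<close> be minimal among the graded right ideals inside \<open>\<Union>I\<^sub>n\<close> that lie in no \<open>I\<^sub>n\<close>. Then \<open>N\<close> is
  hollow: it is not a sum of two proper graded submodules, since those lie in some \<open>I\<^sub>n\<close>. As \<open>N\<close> is
  projective, it has a dual basis, that is, endomorphisms \<open>g\<^sub>p\<close> with \<open>g\<^sub>p N \<subseteq> pR\<close> and \<open>y = \<Sum>g\<^sub>p y\<close>. For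
  \<open>0 \<noteq> y \<in> N\<close> let \<open>h\<close> be the sum of the finitely many \<open>g\<^sub>p\<close> not vanishing at \<open>y\<close>. Its image lies in some
  \<open>I\<^sub>n\<close>, so \<open>1 - h\<close> is onto because \<open>N\<close> is hollow. An epimorphism from a hollow module onto a
  nonzero projective module is injective, although \<open>(1 - h) y = 0\<close>.
\<close>

context graded_ring
begin

section \<open>Graded right ideals and gr-homomorphisms as closure conditions\<close>

abbreviation ideal_module :: "'r set \<Rightarrow> ('g, 'r, 'r) gr_module"
  where "ideal_module \<equiv> induced_module (regular_module R)"

text \<open>A decomposition inside \<open>N\<close> is also one in the whole ring, so by uniqueness
  it consists of the homogeneous parts; conversely, if \<open>N\<close> is closed under
  \<open>homogeneous_part\<close>, these maps serve as projections for \<open>N\<close>. Gradedness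
  thus becomes a closure condition.\<close>

lemma graded_right_ideal_iff:
  "graded_right_ideal \<Gamma> R N \<longleftrightarrow> 0 \<in> N \<and> (\<forall>x\<in>N. \<forall>y\<in>N. x + y \<in> N) \<and> (\<forall>x\<in>N. - x \<in> N) \<and>
    (\<forall>x\<in>N. \<forall>a. x * a \<in> N) \<and> (\<forall>\<gamma>\<in>Mor \<Gamma>. \<forall>x\<in>N. homogeneous_part \<gamma> x \<in> N)"
    (is "?L \<longleftrightarrow> ?R")
proof -
  interpret A: abelian_group "regular_module R" by (rule abelian_group_regular_module)
  have inv: "inv\<^bsub>add_monoid (regular_module R)\<^esub> x = - x" for x
  proof -
    have "\<ominus>\<^bsub>regular_module R\<^esub> x = - x"
      by (rule A.minus_equality) (auto simp: regular_module_def)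
    then show ?thesis by (simp add: a_inv_def)
  qed
  have sg: "subgroup S (add_monoid (regular_module R)) \<longleftrightarrow>
      0 \<in> S \<and> (\<forall>x\<in>S. \<forall>y\<in>S. x + y \<in> S) \<and> (\<forall>x\<in>S. - x \<in> S)" for S
    using inv by (auto simp: subgroup_def regular_module_def)
  have zero: "\<zero>\<^bsub>ideal_module N\<^esub> = 0" by (simp add: induced_module_def regular_module_def)
  show ?thesis
  proof
    assume L: ?L
    then have grp: "0 \<in> N" "\<forall>x\<in>N. \<forall>y\<in>N. x + y \<in> N" "\<forall>x\<in>N. - x \<in> N" and act: "\<forall>x\<in>N. \<forall>a. x * a \<in> N"
      unfolding graded_submodule_def sg by (auto simp: regular_module_def)
    interpret X: graded_module \<Gamma> R "ideal_module N"
      by (rule graded_submodule_graded_module[OF regular_graded_module L])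
    \<comment> \<open>Since the inclusion of \<open>N\<close> is additive, finite sums computed in
      \<open>ideal_module N\<close> are sums in the ring.\<close>
    have id: "(\<lambda>x. x) \<in> hom (add_monoid (ideal_module N)) (add_monoid (regular_module R))"
      by (auto simp: hom_def induced_module_def regular_module_def)
    obtain \<pi> where \<pi>: "projections (ideal_module N) (Mor \<Gamma>) (component (ideal_module N)) \<pi>"
      using internal_direct_sum_projections[OF X.abelian_group_axioms X.module_direct_sum] by blast
    have "homogeneous_part \<gamma> x \<in> N" if g: "\<gamma> \<in> Mor \<Gamma>" and x: "x \<in> N" for \<gamma> x
    proof -
      let ?S = "{i\<in>Mor \<Gamma>. \<pi> i x \<noteq> 0}"
      have x': "x \<in> carrier (ideal_module N)" using x by (simp add: induced_module_def)
      have mem: "\<pi> i x \<in> N \<and> \<pi> i x \<in> R i" if "i \<in> Mor \<Gamma>" for i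
        using \<pi> x' that by (auto simp: projections_def induced_module_def regular_module_def)
      have fin: "finite ?S" and sum: "finsum (ideal_module N) (\<lambda>i. \<pi> i x) ?S = x"
        using \<pi> x' by (auto simp: projections_def zero)
      have "x = sum (\<lambda>i. \<pi> i x) ?S"
        using finsum_additive[OF X.abelian_group_axioms A.abelian_group_axioms id fin, of "\<lambda>i. \<pi> i x"]
          sum mem finsum_regular_module[OF fin, of R "\<lambda>i. \<pi> i x"]
        by (auto simp: induced_module_def)
      then have "homogeneous_part \<gamma> x = (\<Sum>i\<in>?S. homogeneous_part \<gamma> (\<pi> i x))"
        using homogeneous_part_finsum[OF g] by metis
      \<comment> \<open>Each \<open>\<pi> i x\<close> has degree \<open>i\<close>, so taking the
        part of degree \<open>\<gamma>\<close> keeps only the term \<open>i = \<gamma>\<close>. If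
        \<open>\<gamma>\<close> is missing from \<open>?S\<close>, then
        \<open>\<pi> \<gamma> x\<close> is 0 anyway.\<close>
      also have "\<dots> = (\<Sum>i\<in>?S. if i = \<gamma> then \<pi> i x else 0)"
        using mem homogeneous_part(3,4) g by (intro sum.cong) auto
      also have "\<dots> = \<pi> \<gamma> x" using fin g by (auto simp: sum.delta)
      finally show ?thesis using mem[OF g] by simp
    qed
    then show ?R using grp act by auto
  next
    assume R: ?R
    have N: "subgroup N (add_monoid (regular_module R))" using R unfolding sg by auto
    have ag: "abelian_group (ideal_module N)"
    proof (rule abelian_groupI)
      fix x assume "x \<in> carrier (ideal_module N)"
      then show "\<exists>y\<in>carrier (ideal_module N). y \<oplus>\<^bsub>ideal_module N\<^esub> x = \<zero>\<^bsub>ideal_module N\<^esub>"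
        using R by (intro bexI[of _ "- x"]) (auto simp: induced_module_def regular_module_def)
    qed (use R in \<open>auto simp: induced_module_def regular_module_def algebra_simps\<close>)
    have id: "(\<lambda>x. x) \<in> hom (add_monoid (ideal_module N)) (add_monoid (regular_module R))"
      by (auto simp: hom_def induced_module_def regular_module_def)
    have sum: "finsum (ideal_module N) f S = sum f S" if "finite S" "f \<in> S \<rightarrow> N" for f S
      using finsum_additive[OF ag A.abelian_group_axioms id that(1), of f] that
        finsum_regular_module[OF that(1), of R f]
      by (simp add: induced_module_def)
    have "internal_direct_sum (ideal_module N) (Mor \<Gamma>) (\<lambda>\<gamma>. N \<inter> R \<gamma>)"
    proof (rule internal_direct_sumI[OF ag])
      fix \<gamma> assume g: "\<gamma> \<in> Mor \<Gamma>"
      show "subgroup (N \<inter> R \<gamma>) (add_monoid (ideal_module N))"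
      proof (rule group.subgroupI)
        show "group (add_monoid (ideal_module N))" using ag by (rule abelian_group.a_group)
        show "N \<inter> R \<gamma> \<noteq> {}" using R component_props[OF g] by auto
        fix x assume x: "x \<in> N \<inter> R \<gamma>"
        have "\<ominus>\<^bsub>ideal_module N\<^esub> x = - x"
          using x R by (intro abelian_group.minus_equality[OF ag])
            (auto simp: induced_module_def regular_module_def)
        then show "inv\<^bsub>add_monoid (ideal_module N)\<^esub> x \<in> N \<inter> R \<gamma>"
          using x R component_props[OF g] by (simp add: a_inv_def)
      qed (use R component_props[OF g] in \<open>auto simp: induced_module_def regular_module_def\<close>)
    next
      have "finsum (ideal_module N) (\<lambda>\<gamma>. homogeneous_part \<gamma> x) {\<gamma>\<in>Mor \<Gamma>. homogeneous_part \<gamma> x \<noteq> 0} = x"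
        if "x \<in> N" for x
        using sum[OF homogeneous_part_sum(1)] homogeneous_part_sum(2)[of x] R that by auto
      then show "projections (ideal_module N) (Mor \<Gamma>) (\<lambda>\<gamma>. N \<inter> R \<gamma>) homogeneous_part"
        unfolding projections_def zero
        using R homogeneous_part homogeneous_part_sum(1)
        by (auto simp: induced_module_def regular_module_def hom_def)
    qed
    then show ?L using N R by (simp add: graded_submodule_def) (simp add: regular_module_def)
  qed
qed

lemma gr_hom_ideal_module_iff:
  "f \<in> gr_hom \<Gamma> (ideal_module M) (ideal_module N) \<longleftrightarrow> (\<forall>x\<in>M. f x \<in> N) \<and>
    (\<forall>x\<in>M. \<forall>y\<in>M. f (x + y) = f x + f y) \<and> (\<forall>x\<in>M. \<forall>a. f (x * a) = f x * a) \<and>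
    (\<forall>\<sigma>\<in>Mor \<Gamma>. \<forall>x\<in>M \<inter> R \<sigma>. f x \<in> R \<sigma>)"
  by (auto simp: gr_hom_def hom_def induced_module_def regular_module_def image_subset_iff)

lemma graded_right_ideal_sum:
  assumes "graded_right_ideal \<Gamma> R N" "\<And>i. i \<in> S \<Longrightarrow> f i \<in> N"
  shows "sum f S \<in> N"
  using assms by (induction S rule: infinite_finite_induct) (auto simp: graded_right_ideal_iff)

lemma gr_hom_zero_minus:
  assumes "graded_right_ideal \<Gamma> R M" "f \<in> gr_hom \<Gamma> (ideal_module M) (ideal_module N)"
  shows "f 0 = 0" "x \<in> M \<Longrightarrow> f (- x) = - f x"
proof -
  have M: "0 \<in> M" "\<And>x. x \<in> M \<Longrightarrow> - x \<in> M" using assms(1) by (auto simp: graded_right_ideal_iff)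
  have add: "f (x + y) = f x + f y" if "x \<in> M" "y \<in> M" for x y
    using assms(2) that by (auto simp: gr_hom_ideal_module_iff)
  show z: "f 0 = 0" using add[OF M(1,1)] by simp
  show "f (- x) = - f x" if "x \<in> M" for x
    using add[OF that M(2)[OF that]] z by (simp add: eq_neg_iff_add_eq_0 add.commute)
qed

text \<open>\<open>f\<close> is additive and preserves degrees, so it carries the homogeneous
  decomposition of \<open>x\<close> to that of \<open>f x\<close>. This is what makes images and
  kernels graded.\<close>

lemma gr_hom_homogeneous_part:
  assumes M: "graded_right_ideal \<Gamma> R M" and f: "f \<in> gr_hom \<Gamma> (ideal_module M) (ideal_module N)"
    and g: "\<gamma> \<in> Mor \<Gamma>" and x: "x \<in> M"
  shows "f (homogeneous_part \<gamma> x) = homogeneous_part \<gamma> (f x)"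
proof -
  let ?S = "{\<delta>\<in>Mor \<Gamma>. homogeneous_part \<delta> x \<noteq> 0}"
  have mem: "homogeneous_part \<delta> x \<in> M \<inter> R \<delta>" if "\<delta> \<in> Mor \<Gamma>" for \<delta>
    using M x that homogeneous_part(1) by (auto simp: graded_right_ideal_iff)
  have fmem: "f (homogeneous_part \<delta> x) \<in> R \<delta>" if "\<delta> \<in> Mor \<Gamma>" for \<delta>
    using f mem[OF that] that by (auto simp: gr_hom_ideal_module_iff)
  have fsum: "f (sum c S) = (\<Sum>i\<in>S. f (c i))" if "finite S" "\<And>i. i \<in> S \<Longrightarrow> c i \<in> M"
    for c :: "'g \<Rightarrow> 'r" and S
    using that
  proof (induction S rule: finite_induct)
    case empty then show ?case using gr_hom_zero_minus(1)[OF M f] by simp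
  next
    case (insert i S)
    then have "sum c S \<in> M" by (intro graded_right_ideal_sum[OF M]) auto
    then show ?case using insert f by (auto simp: gr_hom_ideal_module_iff)
  qed
  have "f x = f (\<Sum>\<delta>\<in>?S. homogeneous_part \<delta> x)" using homogeneous_part_sum(2)[of x] by simp
  also have "\<dots> = (\<Sum>\<delta>\<in>?S. f (homogeneous_part \<delta> x))"
    using mem by (intro fsum[OF homogeneous_part_sum(1)]) auto
  finally have "homogeneous_part \<gamma> (f x) = (\<Sum>\<delta>\<in>?S. homogeneous_part \<gamma> (f (homogeneous_part \<delta> x)))"
    using homogeneous_part_finsum[OF g] by metis
  also have "\<dots> = (\<Sum>\<delta>\<in>?S. if \<delta> = \<gamma> then f (homogeneous_part \<delta> x) else 0)"
    using fmem homogeneous_part(3,4) g by (intro sum.cong) auto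
  also have "\<dots> = f (homogeneous_part \<gamma> x)"
    using homogeneous_part_sum(1)[of x] g gr_hom_zero_minus(1)[OF M f] by (auto simp: sum.delta)
  finally show ?thesis by simp
qed

section \<open>Images, kernels, unions of chains and differences of maps\<close>

lemma graded_right_ideal_image:
  assumes M: "graded_right_ideal \<Gamma> R M" and f: "f \<in> gr_hom \<Gamma> (ideal_module M) (ideal_module N)"
  shows "graded_right_ideal \<Gamma> R (f ` M)"
  unfolding graded_right_ideal_iff
proof (intro conjI ballI allI)
  have M': "0 \<in> M" "\<And>x y. x \<in> M \<Longrightarrow> y \<in> M \<Longrightarrow> x + y \<in> M" "\<And>x. x \<in> M \<Longrightarrow> - x \<in> M"
      "\<And>x a. x \<in> M \<Longrightarrow> x * a \<in> M" "\<And>x \<gamma>. x \<in> M \<Longrightarrow> \<gamma> \<in> Mor \<Gamma> \<Longrightarrow> homogeneous_part \<gamma> x \<in> M"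
    using M by (auto simp: graded_right_ideal_iff)
  have hom: "\<And>x y. x \<in> M \<Longrightarrow> y \<in> M \<Longrightarrow> f (x + y) = f x + f y" "\<And>x a. x \<in> M \<Longrightarrow> f (x * a) = f x * a"
    using f by (auto simp: gr_hom_ideal_module_iff)
  show "0 \<in> f ` M" using M'(1) gr_hom_zero_minus(1)[OF M f] by force
  show "x + y \<in> f ` M" if "x \<in> f ` M" "y \<in> f ` M" for x y
    using that M'(2) hom(1) by (metis (no_types, lifting) imageE imageI)
  show "- x \<in> f ` M" if "x \<in> f ` M" for x
    using that M'(3) gr_hom_zero_minus(2)[OF M f] by (metis (no_types, lifting) imageE imageI)
  show "x * a \<in> f ` M" if "x \<in> f ` M" for x a
    using that M'(4) hom(2) by (metis (no_types, lifting) imageE imageI)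
  show "homogeneous_part \<gamma> x \<in> f ` M" if "\<gamma> \<in> Mor \<Gamma>" "x \<in> f ` M" for \<gamma> x
    using that M'(5) gr_hom_homogeneous_part[OF M f] by (metis (no_types, lifting) imageE imageI)
qed

lemma graded_right_ideal_kernel:
  assumes M: "graded_right_ideal \<Gamma> R M" and f: "f \<in> gr_hom \<Gamma> (ideal_module M) (ideal_module N)"
  shows "graded_right_ideal \<Gamma> R {x \<in> M. f x = 0}"
proof -
  have "f (x + y) = f x + f y" if "x \<in> M" "y \<in> M" for x y
    using f that by (simp add: gr_hom_ideal_module_iff)
  moreover have "f (x * a) = f x * a" if "x \<in> M" for x a
    using f that by (simp add: gr_hom_ideal_module_iff)
  moreover have "0 \<in> M" "\<And>x y. x \<in> M \<Longrightarrow> y \<in> M \<Longrightarrow> x + y \<in> M" "\<And>x. x \<in> M \<Longrightarrow> - x \<in> M"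
      "\<And>x a. x \<in> M \<Longrightarrow> x * a \<in> M" "\<And>x \<gamma>. x \<in> M \<Longrightarrow> \<gamma> \<in> Mor \<Gamma> \<Longrightarrow> homogeneous_part \<gamma> x \<in> M"
    using M by (auto simp: graded_right_ideal_iff)
  ultimately show ?thesis
    using gr_hom_zero_minus[OF M f] gr_hom_homogeneous_part[OF M f]
    by (simp add: graded_right_ideal_iff homogeneous_part_zero)
qed

text \<open>Two elements of the union lie in a common member of the chain, which gives closure under
  addition; the other closure conditions hold in a single member.\<close>

lemma graded_right_ideal_UN:
  fixes I :: "nat \<Rightarrow> 'r set"
  assumes "\<And>n. graded_right_ideal \<Gamma> R (I n)" "mono I"
  shows "graded_right_ideal \<Gamma> R (\<Union>n. I n)"
  unfolding graded_right_ideal_iff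
proof (intro conjI ballI allI)
  have cl: "0 \<in> I n" "x \<in> I n \<Longrightarrow> y \<in> I n \<Longrightarrow> x + y \<in> I n" "x \<in> I n \<Longrightarrow> - x \<in> I n"
      "x \<in> I n \<Longrightarrow> x * a \<in> I n" "x \<in> I n \<Longrightarrow> \<gamma> \<in> Mor \<Gamma> \<Longrightarrow> homogeneous_part \<gamma> x \<in> I n" for x y a n \<gamma>
    using assms(1)[of n] by (auto simp: graded_right_ideal_iff)
  show "0 \<in> (\<Union>n. I n)" using cl(1) by auto
  show "- x \<in> (\<Union>n. I n)" if "x \<in> (\<Union>n. I n)" for x using cl(3) that by auto
  show "x * a \<in> (\<Union>n. I n)" if "x \<in> (\<Union>n. I n)" for x a using cl(4) that by auto
  show "homogeneous_part \<gamma> x \<in> (\<Union>n. I n)" if "\<gamma> \<in> Mor \<Gamma>" "x \<in> (\<Union>n. I n)" for \<gamma> x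
    using cl(5) that by auto
  fix x y assume "x \<in> (\<Union>n. I n)" "y \<in> (\<Union>n. I n)"
  then obtain m n where "x \<in> I m" "y \<in> I n" by blast
  then have "x \<in> I (max m n)" "y \<in> I (max m n)"
    using monoD[OF assms(2), of m "max m n"] monoD[OF assms(2), of n "max m n"] by auto
  then show "x + y \<in> (\<Union>n. I n)" using cl(2) by blast
qed

text \<open>Supplies the endomorphism \<open>1 - h\<close>. The induction subtracts one
  \<open>g p\<close> at a time; over an infinite \<open>S\<close> the sum is 0 by convention and the
  map is the identity.\<close>

lemma gr_hom_diff_sum:
  assumes N: "graded_right_ideal \<Gamma> R N"
    and g: "\<And>p. p \<in> S \<Longrightarrow> g p \<in> gr_hom \<Gamma> (ideal_module N) (ideal_module N)"
  shows "(\<lambda>y. y - (\<Sum>p\<in>S. g p y)) \<in> gr_hom \<Gamma> (ideal_module N) (ideal_module N)"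
  using g
proof (induction S rule: infinite_finite_induct)
  case (insert p S)
  then have "(\<lambda>y. y - (\<Sum>p\<in>S. g p y)) \<in> gr_hom \<Gamma> (ideal_module N) (ideal_module N)"
    and "g p \<in> gr_hom \<Gamma> (ideal_module N) (ideal_module N)" by auto
  moreover have "x - y \<in> N" if "x \<in> N" "y \<in> N" for x y
    using N that unfolding graded_right_ideal_iff by (metis diff_conv_add_uminus)
  moreover have "x - y \<in> R \<sigma>" if "x \<in> R \<sigma>" "y \<in> R \<sigma>" "\<sigma> \<in> Mor \<Gamma>" for x y \<sigma>
    using component_props[OF that(3)] that by (metis diff_conv_add_uminus)
  ultimately have "(\<lambda>y. (y - (\<Sum>p\<in>S. g p y)) - g p y) \<in> gr_hom \<Gamma> (ideal_module N) (ideal_module N)"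
    unfolding gr_hom_ideal_module_iff by (auto simp: left_diff_distrib)
  then show ?case using insert by (simp add: algebra_simps)
qed (simp_all add: gr_hom_ideal_module_iff)

section \<open>Dual bases of projective graded right ideals\<close>

text \<open>The graded free module on the homogeneous elements of \<open>N\<close> maps onto
  \<open>N\<close>, and projectivity splits this map by some \<open>s\<close>. Then
  \<open>g p y\<close> is \<open>p\<close> times the coordinate of \<open>s y\<close> at
  \<open>p\<close>; finiteness comes from the finite support of \<open>s y\<close>.\<close>

lemma dual_basis:
  assumes N: "graded_right_ideal \<Gamma> R N" and P: "gr_projective \<Gamma> R (ideal_module N)"
  shows "\<exists>g. (\<forall>p\<in>N. g p \<in> gr_hom \<Gamma> (ideal_module N) (ideal_module N)) \<and>
    (\<forall>p\<in>N. \<forall>y\<in>N. g p y \<in> range ((*) p)) \<and> (\<forall>y\<in>N. finite {p\<in>N. g p y \<noteq> 0}) \<and>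
    (\<forall>y\<in>N. (\<Sum>p | p \<in> N \<and> g p y \<noteq> 0. g p y) = y)"
proof -
  define H where "H = (\<Union>\<gamma>\<in>Mor \<Gamma>. N \<inter> R \<gamma>)"
  \<comment> \<open>The choice only matters for \<open>p = 0\<close>, which lies in every component;
    a nonzero homogeneous element has one degree.\<close>
  define dg where "dg p = (SOME \<gamma>. \<gamma> \<in> Mor \<Gamma> \<and> p \<in> R \<gamma>)" for p
  have dgp: "dg p \<in> Mor \<Gamma>" "p \<in> R (dg p)" if "p \<in> H" for p
    using someI_ex[of "\<lambda>\<gamma>. \<gamma> \<in> Mor \<Gamma> \<and> p \<in> R \<gamma>"] that unfolding dg_def H_def by auto
  have HN: "H \<subseteq> N" by (auto simp: H_def)
  interpret free_module \<Gamma> R H dg by unfold_locales (use dgp in auto)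
  \<comment> \<open>The default 0 makes \<open>g p\<close> vanish for non-homogeneous
    \<open>p\<close>, so the family can be indexed by all of \<open>N\<close>.\<close>
  define \<iota> where "\<iota> p = (if p \<in> H then p else 0)" for p
  let ?\<pi> = "free_map (regular_module R) \<iota>"
  have fin: "finite {p. f p \<noteq> 0}" if "f \<in> free_carrier" for f using that by (simp add: free_carrier_def)
  have \<pi>_eq: "?\<pi> f = (\<Sum>p | f p \<noteq> 0. \<iota> p * f p)" if "f \<in> free_carrier" for f
    unfolding free_map_def using finsum_regular_module[OF fin[OF that]]
    by (simp add: regular_module_def)
  have \<iota>N: "\<iota> p * a \<in> N" for p a using N HN by (auto simp: \<iota>_def graded_right_ideal_iff)
  have \<pi>N: "?\<pi> f \<in> N" if "f \<in> free_carrier" for f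
    unfolding \<pi>_eq[OF that] by (rule graded_right_ideal_sum[OF N \<iota>N])
  have \<pi>R: "?\<pi> \<in> gr_hom \<Gamma> free (regular_module R)"
    by (rule free_map_hom[OF regular_graded_module]) (use dgp in \<open>auto simp: \<iota>_def regular_module_def\<close>)
  then have \<pi>: "?\<pi> \<in> gr_hom \<Gamma> free (ideal_module N)"
    using \<pi>N unfolding gr_hom_def hom_def free_component_def
    by (simp add: regular_module_def induced_module_def image_subset_iff Pi_iff free_component_def)
  have add: "?\<pi> (\<lambda>p. f p + f' p) = ?\<pi> f + ?\<pi> f'" if "f \<in> free_carrier" "f' \<in> free_carrier" for f f'
    using \<pi>R that by (auto simp: gr_hom_def hom_def regular_module_def)
  have homog: "p \<in> ?\<pi> ` free_carrier" if p: "p \<in> H" for p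
  proof -
    let ?u = "unit_of R (src \<Gamma> (dg p))"
    \<comment> \<open>The basis vector at \<open>p\<close>: its only nonzero coordinate can be the
      local unit at the domain of \<open>dg p\<close>, and \<open>p * ?u = p\<close> shows that it
      maps to \<open>p\<close>.\<close>
    let ?f = "\<lambda>q. if q = p then ?u else 0"
    have e: "src \<Gamma> (dg p) \<in> identities \<Gamma>" using src_identities dgp[OF p] by simp
    have s: "{q. ?f q \<noteq> 0} \<subseteq> {p}" by auto
    have f: "?f \<in> free_carrier"
      using p unit_of(2)[OF e unit_of(1)[OF e]] finite_subset[OF s] by (auto simp: free_carrier_def)
    have "?\<pi> ?f = (\<Sum>q\<in>{p}. \<iota> q * ?f q)"
      unfolding \<pi>_eq[OF f] using s by (intro sum.mono_neutral_left) auto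
    then have "?\<pi> ?f = p" using p unit_right[OF dgp[OF p]] by (simp add: \<iota>_def)
    then show ?thesis using f by force
  qed
  \<comment> \<open>The image is closed under finite sums, so it suffices that it contains the
    homogeneous elements of \<open>N\<close>.\<close>
  have sums: "sum c S \<in> ?\<pi> ` free_carrier" if "finite S" "\<And>i. i \<in> S \<Longrightarrow> c i \<in> ?\<pi> ` free_carrier"
    for c :: "'g \<Rightarrow> 'r" and S
    using that
  proof (induction S rule: finite_induct)
    case empty
    have z: "(\<lambda>p. 0) \<in> free_carrier" by (simp add: free_carrier_def)
    moreover have "?\<pi> (\<lambda>p. 0) = 0" unfolding \<pi>_eq[OF z] by simp
    ultimately show ?case by force
  next
    case (insert i S)
    then obtain f f' where "f \<in> free_carrier" "c i = ?\<pi> f" "f' \<in> free_carrier" "sum c S = ?\<pi> f'"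
      by blast
    then show ?case using insert add free_carrier_closed(1)[of f f'] by force
  qed
  have "y \<in> ?\<pi> ` free_carrier" if y: "y \<in> N" for y
  proof -
    have "homogeneous_part \<gamma> y \<in> H" if "\<gamma> \<in> Mor \<Gamma>" for \<gamma>
      using that N y homogeneous_part(1) by (auto simp: H_def graded_right_ideal_iff)
    then show ?thesis
      using sums[OF homogeneous_part_sum(1)[of y], of "\<lambda>\<gamma>. homogeneous_part \<gamma> y"] homog
        homogeneous_part_sum(2)[of y] by auto
  qed
  then have surj: "?\<pi> ` carrier free = carrier (ideal_module N)"
    using \<pi>N by (auto simp: induced_module_def)
  \<comment> \<open>Lifting the identity of \<open>N\<close> along the surjection yields the section
    \<open>s\<close>. The carrier types are exactly those in the definition of
    \<open>gr_projective\<close>.\<close>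
  have "lifts_along \<Gamma> (ideal_module N) free (ideal_module N)"
    using P free_graded_module graded_submodule_graded_module[OF regular_graded_module N]
    by (simp add: gr_projective_def)
  moreover have "(\<lambda>x. x) \<in> gr_hom \<Gamma> (ideal_module N) (ideal_module N)"
    by (simp add: gr_hom_ideal_module_iff)
  ultimately obtain s where s: "s \<in> gr_hom \<Gamma> (ideal_module N) free"
    "\<And>x. x \<in> carrier (ideal_module N) \<Longrightarrow> ?\<pi> (s x) = x"
    using \<pi> surj unfolding lifts_along_def by meson
  have \<pi>s: "?\<pi> (s y) = y" if "y \<in> N" for y using s(2) that by (simp add: induced_module_def)
  have sN: "s y \<in> free_carrier" if "y \<in> N" for y
    using s(1) that by (auto simp: gr_hom_def hom_def induced_module_def)
  have shom: "s (x + y) = (\<lambda>p. s x p + s y p)" "s (x * a) = (\<lambda>p. s x p * a)"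
    if "x \<in> N" "y \<in> N" for x y a
    using s(1) that by (auto simp: gr_hom_def hom_def induced_module_def regular_module_def)
  have sR: "s y \<in> free_component \<sigma>" if "y \<in> N" "y \<in> R \<sigma>" "\<sigma> \<in> Mor \<Gamma>" for y \<sigma>
    using s(1) that by (fastforce simp: gr_hom_def induced_module_def regular_module_def)
  let ?g = "\<lambda>p y. \<iota> p * s y p"
  show ?thesis
  proof (intro exI[of _ ?g] conjI ballI)
    fix p assume p: "p \<in> N"
    \<comment> \<open>For \<open>y\<close> of degree \<open>\<sigma>\<close> the coordinate of
      \<open>s y\<close> at \<open>p\<close> has degree \<open>shift p \<sigma>\<close>, which
      \<open>dg p\<close> composes back to \<open>\<sigma>\<close>. Otherwise a factor
      vanishes.\<close>
    have deg: "\<iota> p * s y p \<in> R \<sigma>" if y: "y \<in> N" "y \<in> R \<sigma>" and \<sigma>: "\<sigma> \<in> Mor \<Gamma>" for y \<sigma>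
    proof (cases "p \<in> H \<and> tgt \<Gamma> \<sigma> = tgt \<Gamma> (dg p)")
      case True
      note sh = shift[of p \<sigma>, OF _ \<sigma>]
      have "s y p \<in> R (shift p \<sigma>)" using sR[OF y \<sigma>] True by (auto simp: free_component_def)
      then have "p * s y p \<in> R (cmp \<Gamma> (dg p) (shift p \<sigma>))"
        using True sh dgp by (intro ring_mult_comp) auto
      then show ?thesis using True sh(4) by (simp add: \<iota>_def)
    next
      case False
      then have "\<iota> p * s y p = 0" using sR[OF y \<sigma>] by (auto simp: free_component_def \<iota>_def)
      then show ?thesis using component_props(1)[OF \<sigma>] by simp
    qed
    then show "?g p \<in> gr_hom \<Gamma> (ideal_module N) (ideal_module N)"
      using \<iota>N shom by (auto simp: gr_hom_ideal_module_iff distrib_left mult.assoc)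
    show "?g p y \<in> range ((*) p)" for y
      by (cases "p \<in> H") (auto simp: \<iota>_def intro: image_eqI[of _ _ 0])
  next
    fix y assume y: "y \<in> N"
    have sub: "{p\<in>N. ?g p y \<noteq> 0} \<subseteq> {p. s y p \<noteq> 0}" by auto
    show "finite {p\<in>N. ?g p y \<noteq> 0}" by (rule finite_subset[OF sub fin[OF sN[OF y]]])
    \<comment> \<open>The extra indices contribute 0, so this is the value of the free map at
      \<open>s y\<close>, namely \<open>y\<close>.\<close>
    have "(\<Sum>p\<in>{p\<in>N. ?g p y \<noteq> 0}. ?g p y) = (\<Sum>p | s y p \<noteq> 0. ?g p y)"
      using HN by (intro sum.mono_neutral_left fin[OF sN[OF y]] sub) (auto simp: \<iota>_def split: if_splits)
    then show "(\<Sum>p | p \<in> N \<and> ?g p y \<noteq> 0. ?g p y) = y" using \<pi>_eq[OF sN[OF y]] \<pi>s[OF y] by simp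
  qed
qed

section \<open>Contradiction from a minimal projective ideal\<close>

text \<open>The artinian condition enters through \<open>min\<close> and heredity through
  \<open>P\<close>. Hollowness is used twice in spirit: to make \<open>u = 1 - h\<close> onto, and
  to rule out the splitting of \<open>N\<close> that a section of \<open>u\<close> provides.\<close>

lemma projective_not_hollow_union:
  fixes I :: "nat \<Rightarrow> 'r set"
  assumes N: "graded_right_ideal \<Gamma> R N" and P: "gr_projective \<Gamma> R (ideal_module N)"
    and I: "\<And>n. graded_right_ideal \<Gamma> R (I n)" "mono I"
    and NI: "N \<subseteq> (\<Union>n. I n)" "\<And>n. \<not> N \<subseteq> I n"
    and min: "\<And>A. graded_right_ideal \<Gamma> R A \<Longrightarrow> A \<subset> N \<Longrightarrow> \<exists>n. A \<subseteq> I n"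
  shows False
proof -
  have hollow: "A = N \<or> B = N"
    if AB: "graded_right_ideal \<Gamma> R A" "A \<subseteq> N" "graded_right_ideal \<Gamma> R B" "B \<subseteq> N"
      and sum: "\<And>x. x \<in> N \<Longrightarrow> \<exists>a\<in>A. \<exists>b\<in>B. x = a + b" for A B
  proof (rule ccontr)
    assume "\<not> (A = N \<or> B = N)"
    then obtain m n where "A \<subseteq> I m" "B \<subseteq> I n" using min AB by (metis psubsetI)
    then have "A \<subseteq> I (max m n)" "B \<subseteq> I (max m n)"
      using monoD[OF I(2), of m "max m n"] monoD[OF I(2), of n "max m n"] by auto
    then have "N \<subseteq> I (max m n)"
      using sum I(1)[of "max m n"] unfolding graded_right_ideal_iff by blast
    then show False using NI(2) by blast
  qed
  have N0: "0 \<in> N" "0 \<in> I 0" using N I(1)[of 0] by (auto simp: graded_right_ideal_iff)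
  \<comment> \<open>An element of \<open>N\<close> outside \<open>I 0\<close> is nonzero because
    \<open>0 \<in> I 0\<close>.\<close>
  then obtain y where y: "y \<in> N" "y \<noteq> 0" using NI(2)[of 0] by auto
  obtain g where g: "\<And>p. p \<in> N \<Longrightarrow> g p \<in> gr_hom \<Gamma> (ideal_module N) (ideal_module N)"
    "\<And>p y. p \<in> N \<Longrightarrow> y \<in> N \<Longrightarrow> g p y \<in> range ((*) p)"
    "\<And>y. y \<in> N \<Longrightarrow> finite {p\<in>N. g p y \<noteq> 0}"
    "\<And>y. y \<in> N \<Longrightarrow> (\<Sum>p | p \<in> N \<and> g p y \<noteq> 0. g p y) = y"
    using dual_basis[OF N P] by blast
  \<comment> \<open>Only the indices active at this one \<open>y\<close> are kept: the sum over the
    finite set \<open>S\<close> reproduces \<open>y\<close>, though not every element of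
    \<open>N\<close>, so \<open>u y = 0\<close>.\<close>
  define S where "S = {p\<in>N. g p y \<noteq> 0}"
  have S: "finite S" "S \<subseteq> N" using g(3)[OF y(1)] by (auto simp: S_def)
  define u where "u z = z - (\<Sum>p\<in>S. g p z)" for z
  have u: "u \<in> gr_hom \<Gamma> (ideal_module N) (ideal_module N)"
    unfolding u_def by (rule gr_hom_diff_sum[OF N]) (use g(1) S in auto)
  have uy: "u y = 0" using g(4)[OF y(1)] by (simp add: u_def S_def)
  have "\<exists>n. S \<subseteq> I n"
  proof -
    have "\<forall>p\<in>S. \<exists>n. p \<in> I n" using S(2) NI(1) by blast
    then obtain k where k: "\<And>p. p \<in> S \<Longrightarrow> p \<in> I (k p)" by metis
    have "I (k p) \<subseteq> I (Max (k ` S))" if "p \<in> S" for p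
      using monoD[OF I(2)] S(1) that by simp
    then show ?thesis using k by blast
  qed
  then obtain n where n: "S \<subseteq> I n" by blast
  \<comment> \<open>Each \<open>g p z\<close> is a right multiple of \<open>p\<close>, so
    \<open>S \<subseteq> I n\<close> bounds the whole image of the sum, whatever \<open>z\<close>
    is.\<close>
  have small: "(\<Sum>p\<in>S. g p z) \<in> I n" if z: "z \<in> N" for z
  proof (rule graded_right_ideal_sum[OF I(1)])
    fix p assume p: "p \<in> S"
    then obtain a where "g p z = p * a" using g(2) z S(2) by blast
    then show "g p z \<in> I n" using p n I(1)[of n] by (auto simp: graded_right_ideal_iff)
  qed
  have uN: "u ` N \<subseteq> N" using u by (auto simp: gr_hom_ideal_module_iff)
  have surj: "u ` N = N"
  \<comment> \<open>A proper image of \<open>u\<close> would lie in some \<open>I m\<close>, and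
    \<open>z = u z + h z\<close> would then put all of \<open>N\<close> into one member of the
    chain.\<close>
  proof (rule ccontr)
    assume "u ` N \<noteq> N"
    then obtain m where m: "u ` N \<subseteq> I m"
      using min[OF graded_right_ideal_image[OF N u]] uN by blast
    have "z \<in> I (max m n)" if z: "z \<in> N" for z
    proof -
      have "u z \<in> I (max m n)" "(\<Sum>p\<in>S. g p z) \<in> I (max m n)"
        using m z small[OF z] monoD[OF I(2), of m "max m n"] monoD[OF I(2), of n "max m n"] by auto
      moreover have "z = u z + (\<Sum>p\<in>S. g p z)" by (simp add: u_def)
      ultimately show ?thesis using I(1)[of "max m n"] unfolding graded_right_ideal_iff by metis
    qed
    then show False using NI(2) by blast
  qed
  \<comment> \<open>The module mapped onto \<open>N\<close> is now \<open>N\<close> itself, whose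
    carrier type differs from the one in \<open>gr_projective\<close>; hence the transfer
    theorem.\<close>
  have "lifts_along \<Gamma> (ideal_module N) (ideal_module N) (ideal_module N)"
    using gr_projective_lifts_along[OF graded_ring_axioms P]
      graded_submodule_graded_module[OF regular_graded_module N] by blast
  moreover have "(\<lambda>x. x) \<in> gr_hom \<Gamma> (ideal_module N) (ideal_module N)"
    by (simp add: gr_hom_ideal_module_iff)
  moreover have "u ` carrier (ideal_module N) = carrier (ideal_module N)"
    using surj by (simp add: induced_module_def)
  ultimately obtain v where v: "v \<in> gr_hom \<Gamma> (ideal_module N) (ideal_module N)"
    and "\<forall>x\<in>carrier (ideal_module N). u (v x) = x"
    using u unfolding lifts_along_def by meson
  then have uv: "u (v x) = x" if "x \<in> N" for x using that by (simp add: induced_module_def)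
  have vN: "v x \<in> N" if "x \<in> N" for x using v that by (simp add: gr_hom_ideal_module_iff)
  \<comment> \<open>\<open>N\<close> is the sum of the kernel of \<open>u\<close> and the image of
    its section \<open>v\<close>, via \<open>x = (x - v (u x)) + v (u x)\<close>; hollowness makes
    one of them all of \<open>N\<close>.\<close>
  have "{x \<in> N. u x = 0} = N \<or> v ` N = N"
  proof (rule hollow)
    fix x assume x: "x \<in> N"
    let ?z = "v (u x)"
    have ux: "u x \<in> N" using x uN by blast
    have mz: "- ?z \<in> N" using N vN[OF ux] by (simp add: graded_right_ideal_iff)
    have "u (x + - ?z) = u x + u (- ?z)" using u x mz unfolding gr_hom_ideal_module_iff by blast
    also have "\<dots> = 0" using gr_hom_zero_minus(2)[OF N u vN[OF ux]] uv[OF ux] by simp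
    finally have "u (x + - ?z) = 0" .
    moreover have "x + - ?z \<in> N" using N x mz unfolding graded_right_ideal_iff by blast
    ultimately have "x + - ?z \<in> {x \<in> N. u x = 0}" by blast
    moreover have "x = (x + - ?z) + ?z" by simp
    ultimately show "\<exists>a\<in>{x \<in> N. u x = 0}. \<exists>b\<in>v ` N. x = a + b" using ux by blast
  qed (use graded_right_ideal_kernel[OF N u] graded_right_ideal_image[OF N v] vN in auto)
  then show False
  proof
    \<comment> \<open>Then \<open>u\<close> is zero and yet onto the nonzero module
      \<open>N\<close>.\<close>
    assume "{x \<in> N. u x = 0} = N"
    then show False using surj y by force
  next
    \<comment> \<open>Here \<open>y = v z\<close> gives \<open>z = u (v z) = u y = 0\<close>, hence
      \<open>y = v 0 = 0\<close>.\<close>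
    assume "v ` N = N"
    then obtain z where "z \<in> N" "y = v z" using y by blast
    then show False using uv uy y gr_hom_zero_minus(1)[OF N v] by metis
  qed
qed

end

section \<open>A minimal graded right ideal contained in no member of the chain\<close>

theorem corollary7p10:
  fixes \<Gamma> :: "'g category" and R :: "'g \<Rightarrow> 'r::ring set"
  assumes "graded_ring \<Gamma> R"
    and "right_artinian \<Gamma> R"
    and "right_gr_hereditary \<Gamma> R"
  shows "right_noetherian \<Gamma> R"
  unfolding right_noetherian_def
proof (intro ballI notI)
  interpret graded_ring \<Gamma> R by fact
  fix e assume e: "e \<in> identities \<Gamma>"
  assume "\<exists>I :: nat \<Rightarrow> 'r set. \<forall>n. graded_right_ideal \<Gamma> R (I n) \<and>
      I n \<subseteq> range (\<lambda>a. unit_of R e * a) \<and> I n \<subset> I (Suc n)"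
  then obtain I :: "nat \<Rightarrow> 'r set" where I: "\<And>n. graded_right_ideal \<Gamma> R (I n)"
    "\<And>n. I n \<subseteq> range (\<lambda>a. unit_of R e * a)" "\<And>n. I n \<subset> I (Suc n)" by blast
  have inc: "mono I" by (rule monoI, rule lift_Suc_mono_le) (use I(3) in blast)+
  define bad where "bad N \<longleftrightarrow> graded_right_ideal \<Gamma> R N \<and> N \<subseteq> (\<Union>n. I n) \<and> (\<forall>n. \<not> N \<subseteq> I n)" for N
  \<comment> \<open>The union lies in no \<open>I n\<close>, because \<open>I (Suc n)\<close>
    already does not.\<close>
  have top: "bad (\<Union>n. I n)"
    unfolding bad_def using graded_right_ideal_UN[OF I(1) inc] I(3) by blast
  have "\<exists>N. bad N \<and> (\<forall>A. A \<subset> N \<longrightarrow> \<not> bad A)"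
  proof (rule ccontr)
    assume "\<nexists>N. bad N \<and> (\<forall>A. A \<subset> N \<longrightarrow> \<not> bad A)"
    then have "\<exists>A. bad A \<and> A \<subset> N" if "bad N" for N using that by blast
    \<comment> \<open>Without a minimal bad ideal, dependent choice starting from the union produces
      an infinite descending sequence; it stays inside \<open>1_e R\<close> because every
      \<open>I n\<close> does.\<close>
    then obtain J where J: "\<And>n. bad (J n)" "\<And>n. J (Suc n) \<subset> J n"
      using dependent_nat_choice[of "\<lambda>_. bad" "\<lambda>_ N A. A \<subset> N"] top by metis
    have "graded_right_ideal \<Gamma> R (J n) \<and> J n \<subseteq> range (\<lambda>a. unit_of R e * a) \<and> J (Suc n) \<subset> J n" for n
    proof (intro conjI)
      show "graded_right_ideal \<Gamma> R (J n)" using J(1) by (simp add: bad_def)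
      show "J n \<subseteq> range (\<lambda>a. unit_of R e * a)" using J(1)[of n] I(2) unfolding bad_def by blast
    qed (rule J(2))
    then show False using assms(2) e unfolding right_artinian_def by metis
  qed
  then obtain N where N: "bad N" "\<And>A. A \<subset> N \<Longrightarrow> \<not> bad A" by blast
  show False
  proof (rule projective_not_hollow_union[OF _ _ I(1) inc])
    show id: "graded_right_ideal \<Gamma> R N" "N \<subseteq> (\<Union>n. I n)" "\<And>n. \<not> N \<subseteq> I n"
      using N(1) by (auto simp: bad_def)
    \<comment> \<open>This is the use of heredity: \<open>N\<close> is a graded right ideal of the
      ring.\<close>
    show "gr_projective \<Gamma> R (ideal_module N)"
      using assms(3) id(1) by (simp add: right_gr_hereditary_def)
    show "\<exists>n. A \<subseteq> I n" if "graded_right_ideal \<Gamma> R A" "A \<subset> N" for A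
      using N(2)[OF that(2)] that id(2) unfolding bad_def by blast
  qed
qed

end
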